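(* Let $X$ be a complex Banach space and let $A\subseteq B(X)$ be an abelian, unital, strongly closed subalgebra with spectral synthesis. If $A$ has split strict multiplicity $s.s.m.(A)=p\in\mathbb{N}$, then $A$ is reflexive.
   Context: $B(X)$ is the algebra of bounded linear operators on $X$; "strongly closed" means closed in the strong operator topology; $A$ carries the operator norm. An algebra $A\subset B(X)$ has split strict multiplicity $p\in\mathbb{N}$, written $s.s.m.(A)=p$, if there are $x_1,\dots,x_p\in X$ such that the subspaces $X_i=\{ax_i : a\in A\}$ are closed and $X=X_1\oplus\cdots\oplus X_p$. $A$ (as an abelian unital Banach algebra) has spectral synthesis if every norm closed ideal of $A$ is the intersection of the maximal ideals of $A$ containing it. $Lat(A)$ is the set of closed subspaces of $X$ invariant under every $a\in A$, $algLat(A)=\{T\in B(X) : TK\subseteq K \text{ for every } K\in Lat(A)\}$, and $A$ is reflexive if $A=algLat(A)$. *)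

theory Defs
  imports "HOL-Analysis.Analysis"
begin

section \<open>Complex Banach spaces\<close>

class complex_normed_vector = real_normed_vector +
  fixes scaleC :: "complex \<Rightarrow> 'a \<Rightarrow> 'a"  (infixr \<open>*\<^sub>C\<close> 75)
  assumes scaleC_add_right: "c *\<^sub>C (x + y) = c *\<^sub>C x + c *\<^sub>C y"
    and scaleC_add_left: "(c + d) *\<^sub>C x = c *\<^sub>C x + d *\<^sub>C x"
    and scaleC_scaleC: "c *\<^sub>C (d *\<^sub>C x) = (c * d) *\<^sub>C x"
    and scaleC_of_real: "complex_of_real r *\<^sub>C x = r *\<^sub>R x"
    and norm_scaleC: "norm (c *\<^sub>C x) = cmod c * norm x"

class complex_banach = complex_normed_vector + complete_space

subclass (in complex_banach) banach ..

global_interpretation complex_vector: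
  vector_space "scaleC :: complex \<Rightarrow> 'a \<Rightarrow> 'a::complex_normed_vector"
proof
  show "1 *\<^sub>C x = x" for x :: 'a
    using scaleC_of_real[of 1 x] by simp
qed (simp_all add: scaleC_add_right scaleC_add_left scaleC_scaleC)

abbreviation csubspace :: "'a::complex_normed_vector set \<Rightarrow> bool"
  where "csubspace \<equiv> complex_vector.subspace"

abbreviation clinear :: "('a::complex_normed_vector \<Rightarrow> 'b::complex_normed_vector) \<Rightarrow> bool"
  where "clinear \<equiv> Vector_Spaces.linear scaleC scaleC"

instantiation complex :: complex_banach
begin

definition scaleC_complex :: "complex \<Rightarrow> complex \<Rightarrow> complex"
  where "scaleC_complex c z = c * z"

instance
  by standard (simp_all add: scaleC_complex_def algebra_simps norm_mult scaleR_conv_of_real)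

end

lemma bounded_linear_scaleC: "bounded_linear (\<lambda>x::'a::complex_normed_vector. c *\<^sub>C x)"
proof (rule bounded_linear_intro)
  show "c *\<^sub>C (x + y) = c *\<^sub>C x + c *\<^sub>C y" for x y :: 'a
    by (rule scaleC_add_right)
  show "c *\<^sub>C (r *\<^sub>R x) = r *\<^sub>R (c *\<^sub>C x)" for r and x :: 'a
    by (simp add: scaleC_scaleC mult.commute flip: scaleC_of_real)
  show "norm (c *\<^sub>C x) \<le> norm x * cmod c" for x :: 'a
    by (simp add: norm_scaleC)
qed

text \<open>Operators carry the operator norm of \<^typ>\<open>'a \<Rightarrow>\<^sub>L 'b\<close> and the pointwise complex scaling.\<close>

instantiation blinfun :: (real_normed_vector, complex_normed_vector) complex_normed_vector
begin

definition scaleC_blinfun :: "complex \<Rightarrow> ('a \<Rightarrow>\<^sub>L 'b) \<Rightarrow> ('a \<Rightarrow>\<^sub>L 'b)"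
  where "scaleC_blinfun c T = Blinfun (\<lambda>x. c *\<^sub>C blinfun_apply T x)"

lemma blinfun_apply_scaleC:
  "blinfun_apply (c *\<^sub>C T) x = c *\<^sub>C blinfun_apply T x"
  unfolding scaleC_blinfun_def
  by (subst bounded_linear_Blinfun_apply)
    (auto intro: bounded_linear_compose[OF bounded_linear_scaleC] blinfun.bounded_linear_right)

instance
proof
  fix c d :: complex and r :: real and S T :: "'a \<Rightarrow>\<^sub>L 'b"
  show "c *\<^sub>C (S + T) = c *\<^sub>C S + c *\<^sub>C T"
    by (rule blinfun_eqI) (simp add: blinfun_apply_scaleC blinfun.add_left scaleC_add_right)
  show "(c + d) *\<^sub>C T = c *\<^sub>C T + d *\<^sub>C T"
    by (rule blinfun_eqI) (simp add: blinfun_apply_scaleC blinfun.add_left scaleC_add_left)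
  show "c *\<^sub>C (d *\<^sub>C T) = (c * d) *\<^sub>C T"
    by (rule blinfun_eqI) (simp add: blinfun_apply_scaleC scaleC_scaleC)
  show of_real: "complex_of_real r *\<^sub>C T = r *\<^sub>R T" for r and T :: "'a \<Rightarrow>\<^sub>L 'b"
    by (rule blinfun_eqI) (simp add: blinfun_apply_scaleC blinfun.scaleR_left scaleC_of_real)
  have le: "norm (c *\<^sub>C T) \<le> cmod c * norm T" for c and T :: "'a \<Rightarrow>\<^sub>L 'b"
  proof (rule norm_blinfun_bound)
    show "norm (blinfun_apply (c *\<^sub>C T) x) \<le> cmod c * norm T * norm x" for x
      using mult_left_mono[OF norm_blinfun[of T x], of "cmod c"]
      by (simp add: blinfun_apply_scaleC norm_scaleC mult.assoc)
  qed simp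
  show "norm (c *\<^sub>C T) = cmod c * norm T"
  proof (cases "c = 0")
    case True
    then show ?thesis using le[of 0 T] by simp
  next
    case False
    have "T = inverse c *\<^sub>C (c *\<^sub>C T)"
      using False of_real[of 1 T]
      by (intro blinfun_eqI) (simp add: blinfun_apply_scaleC scaleC_scaleC)
    then have "norm T \<le> inverse (cmod c) * norm (c *\<^sub>C T)"
      using le[of "inverse c" "c *\<^sub>C T"] by (simp add: norm_inverse)
    then have "cmod c * norm T \<le> norm (c *\<^sub>C T)"
      using False by (simp add: field_simps)
    with le[of c T] show ?thesis by simp
  qed
qed

end


section \<open>Operator algebras\<close>

text \<open>
  The library type of bounded operators is real-linear; \<open>B(X)\<close> is its subset of
  complex-linear operators.
\<close>

definition bounded_operators :: "('a::complex_banach \<Rightarrow>\<^sub>L 'a) set"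
  where "bounded_operators = {T. clinear (blinfun_apply T)}"

definition operator_algebra :: "('a::complex_banach \<Rightarrow>\<^sub>L 'a) set \<Rightarrow> bool"
  where "operator_algebra A \<longleftrightarrow>
    A \<subseteq> bounded_operators \<and> csubspace A \<and> (\<forall>a\<in>A. \<forall>b\<in>A. a o\<^sub>L b \<in> A)"

definition abelian :: "('a::complex_banach \<Rightarrow>\<^sub>L 'a) set \<Rightarrow> bool"
  where "abelian A \<longleftrightarrow> (\<forall>a\<in>A. \<forall>b\<in>A. a o\<^sub>L b = b o\<^sub>L a)"

definition unital :: "('a::complex_banach \<Rightarrow>\<^sub>L 'a) set \<Rightarrow> bool"
  where "unital A \<longleftrightarrow> id_blinfun \<in> A"

definition strongly_closed :: "('a::complex_banach \<Rightarrow>\<^sub>L 'a) set \<Rightarrow> bool"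
  where "strongly_closed A \<longleftrightarrow>
    closedin (subtopology strong_operator_topology bounded_operators) A"


section \<open>Ideals and spectral synthesis\<close>

definition algebra_ideal ::
    "('a::complex_banach \<Rightarrow>\<^sub>L 'a) set \<Rightarrow> ('a \<Rightarrow>\<^sub>L 'a) set \<Rightarrow> bool"
  where "algebra_ideal A I \<longleftrightarrow>
    I \<subseteq> A \<and> csubspace I \<and> (\<forall>a\<in>A. \<forall>b\<in>I. a o\<^sub>L b \<in> I \<and> b o\<^sub>L a \<in> I)"

definition maximal_algebra_ideal ::
    "('a::complex_banach \<Rightarrow>\<^sub>L 'a) set \<Rightarrow> ('a \<Rightarrow>\<^sub>L 'a) set \<Rightarrow> bool"
  where "maximal_algebra_ideal A M \<longleftrightarrow>
    algebra_ideal A M \<and> M \<noteq> A \<and>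
    (\<forall>J. algebra_ideal A J \<and> M \<subseteq> J \<longrightarrow> J = M \<or> J = A)"

text \<open>
  The intersection is taken inside \<open>A\<close>, so that the empty intersection, which occurs for
  \<open>I = A\<close>, is \<open>A\<close>.
\<close>

definition spectral_synthesis :: "('a::complex_banach \<Rightarrow>\<^sub>L 'a) set \<Rightarrow> bool"
  where "spectral_synthesis A \<longleftrightarrow>
    (\<forall>I. algebra_ideal A I \<and> closedin (top_of_set A) I \<longrightarrow>
      I = A \<inter> \<Inter>{M. maximal_algebra_ideal A M \<and> I \<subseteq> M})"


section \<open>Split strict multiplicity\<close>

definition orbit :: "('a::complex_banach \<Rightarrow>\<^sub>L 'a) set \<Rightarrow> 'a \<Rightarrow> 'a set"
  where "orbit A x = {blinfun_apply a x | a. a \<in> A}"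

text \<open>The whole space is the internal direct sum of \<open>S 0, \<dots>, S (p - 1)\<close>.\<close>

definition direct_sum_decomposition :: "nat \<Rightarrow> (nat \<Rightarrow> 'a::complex_banach set) \<Rightarrow> bool"
  where "direct_sum_decomposition p S \<longleftrightarrow>
    (\<forall>i<p. csubspace (S i)) \<and>
    (\<forall>x. \<exists>!y. y \<in> (\<Pi>\<^sub>E i\<in>{..<p}. S i) \<and> x = (\<Sum>i<p. y i))"

definition has_split_strict_multiplicity ::
    "('a::complex_banach \<Rightarrow>\<^sub>L 'a) set \<Rightarrow> nat \<Rightarrow> bool"
  where "has_split_strict_multiplicity A p \<longleftrightarrow>
    (\<exists>x :: nat \<Rightarrow> 'a.
      (\<forall>i<p. closed (orbit A (x i))) \<and>
      direct_sum_decomposition p (\<lambda>i. orbit A (x i)))"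


section \<open>Reflexivity\<close>

definition Lat :: "('a::complex_banach \<Rightarrow>\<^sub>L 'a) set \<Rightarrow> 'a set set"
  where "Lat A = {K. csubspace K \<and> closed K \<and> (\<forall>a\<in>A. blinfun_apply a ` K \<subseteq> K)}"

definition algLat :: "('a::complex_banach \<Rightarrow>\<^sub>L 'a) set \<Rightarrow> ('a \<Rightarrow>\<^sub>L 'a) set"
  where "algLat A = {T \<in> bounded_operators. \<forall>K\<in>Lat A. blinfun_apply T ` K \<subseteq> K}"

definition reflexive :: "('a::complex_banach \<Rightarrow>\<^sub>L 'a) set \<Rightarrow> bool"
  where "reflexive A \<longleftrightarrow> A = algLat A"

end

theory Submission
  imports Defs "HOL-Probability.Discrete_Topology"
begin

text \<open>
  Write \<open>X\<^sub>i = A x\<^sub>i\<close> and \<open>I\<^sub>i = {a. a x\<^sub>i = 0}\<close>. By the open mapping theorem for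
  \<open>(a\<^sub>i) \<mapsto> \<Sum>\<^sub>i a\<^sub>i x\<^sub>i\<close> the projections onto the \<open>X\<^sub>i\<close> are continuous and \<open>M x\<^sub>i\<close> is closed for
  every closed ideal \<open>M \<supseteq> I\<^sub>i\<close>. Let \<open>T \<in> algLat A\<close>. A maximal ideal \<open>M \<supseteq> I\<^sub>i\<close> has codimension one
  (Gelfand--Mazur), so invariance of \<open>M x\<^sub>i\<close> gives \<open>T a x\<^sub>i = a T x\<^sub>i\<close> modulo \<open>M x\<^sub>i\<close>; spectral
  synthesis for \<open>I\<^sub>i\<close> turns this into an equality. Finally \<open>T\<close> leaves the closure of
  \<open>A (x\<^sub>1 + \<dots> + x\<^sub>p)\<close> invariant, which yields \<open>a\<^sub>n \<in> A\<close> with \<open>a\<^sub>n x\<^sub>i \<rightarrow> T x\<^sub>i\<close> for all \<open>i\<close>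
  simultaneously, hence \<open>a\<^sub>n \<rightarrow> T\<close> strongly.

  The proof of Gelfand--Mazur is Rickart's: Hahn--Banach and contour integrals are replaced by
  means of the resolvent over the roots of unity of order \<open>2\<^sup>n\<close>.
\<close>

section \<open>The open mapping theorem on a closed subspace\<close>

text \<open>Banach's argument: Baire category makes approximate preimages of controlled norm
  available, and successive approximation makes them exact. A closed subspace \<open>S\<close>
  serves as the domain because the intended domain, a copy of \<open>A ^ p\<close>, is only a subset
  of a Banach space type.\<close>

lemma open_mapping_bound:
  fixes f :: "'b::banach \<Rightarrow> 'c::banach"
  assumes f: "bounded_linear f" and S: "closed S" "subspace S" and onto: "f ` S = UNIV"
  obtains C where "C \<ge> 0" "\<And>y. \<exists>x\<in>S. f x = y \<and> norm x \<le> C * norm y"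
proof -
  interpret f: bounded_linear f by (rule f)
  define V where "V n = closure (f ` (S \<inter> cball 0 (real n)))" for n
  have "\<exists>n. interior (V n) \<noteq> {}"
  proof (rule ccontr)
    assume none: "\<nexists>n. interior (V n) \<noteq> {}"
    have "euclidean interior_of (\<Union>(range V)) = {}"
      unfolding mtopology_is_euclidean[symmetric]
      using none
      by (intro Met_TC.metric_Baire_category_alt)
        (auto simp: V_def mcomplete_iff_complete complete_UNIV)
    moreover have "\<Union>(range V) = UNIV"
    proof (intro set_eqI iffI UNIV_I)
      fix y :: 'c
      obtain x where "x \<in> S" "f x = y" using onto by (metis UNIV_I imageE)
      moreover obtain n where "norm x \<le> real n" using real_arch_simple by blast
      ultimately have "y \<in> V n"
        unfolding V_def by (intro subsetD[OF closure_subset]) auto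
      then show "y \<in> \<Union>(range V)" by blast
    qed
    ultimately show False by simp
  qed
  then obtain n y0 where "y0 \<in> interior (V n)" by blast
  then obtain r where r: "r > 0" "ball y0 r \<subseteq> V n"
    by (meson mem_interior)
  \<comment> \<open>Subtracting an approximate preimage of \<open>y0\<close> from one of
    \<open>y0 + y\<close> moves the ball to the origin and doubles the norm bound.\<close>
  have approx: "\<exists>x\<in>S. norm x \<le> 2 * real n \<and> norm (y - f x) < e" if "norm y < r" "e > 0" for y e
  proof -
    have "y0 + y \<in> V n" "y0 \<in> V n" using r that by (auto simp: dist_norm)
    then obtain u v where u: "u \<in> S" "norm u \<le> n" "norm (f u - (y0 + y)) < e / 2"
      and v: "v \<in> S" "norm v \<le> n" "norm (f v - y0) < e / 2"
      unfolding V_def closure_approachable using \<open>e > 0\<close>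
      by (fastforce simp: dist_norm dest: spec[of _ "e / 2"])
    have "norm (y - f (u - v)) \<le> norm (f u - (y0 + y)) + norm (f v - y0)"
      using norm_triangle_ineq4[of "f v - y0" "f u - (y0 + y)"] by (simp add: f.diff algebra_simps)
    moreover have "norm (u - v) \<le> 2 * real n" using u v norm_triangle_ineq4[of u v] by linarith
    ultimately show ?thesis using u v subspace_diff[OF S(2)] by (intro bexI[of _ "u - v"]) auto
  qed
  \<comment> \<open>Dividing \<open>y\<close> by \<open>c = 2 * norm y / r\<close> gives a vector of
    norm \<open>r / 2\<close>. Scaling its approximate preimage back costs the factor
    \<open>c\<close>: the norm is at most \<open>c * 2 * n\<close>, and the error
    \<open>r / 4\<close> becomes \<open>norm y / 2\<close>.\<close>
  define K where "K = 4 * real n / r"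
  have K: "K \<ge> 0" using r by (simp add: K_def)
  have "\<exists>x\<in>S. norm x \<le> K * norm y \<and> norm (y - f x) \<le> norm y / 2" for y
  proof (cases "y = 0")
    case True
    then show ?thesis using subspace_0[OF S(2)] by (intro bexI[of _ 0]) (auto simp: f.zero)
  next
    case False
    define c where "c = 2 * norm y / r"
    have c: "c > 0" using r False by (simp add: c_def)
    have "norm (y /\<^sub>R c) < r" using r False by (simp add: c_def)
    from approx[OF this, of "r / 4"] r obtain x where
      x: "x \<in> S" "norm x \<le> 2 * real n" "norm (y /\<^sub>R c - f x) < r / 4" by auto
    have "y - f (c *\<^sub>R x) = c *\<^sub>R (y /\<^sub>R c - f x)"
      using c by (simp add: f.scaleR algebra_simps)
    then have "norm (y - f (c *\<^sub>R x)) = c * norm (y /\<^sub>R c - f x)" using c by simp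
    also have "\<dots> \<le> c * (r / 4)" using x c by (intro mult_left_mono) auto
    also have "\<dots> = norm y / 2" using r by (simp add: c_def)
    finally have "norm (y - f (c *\<^sub>R x)) \<le> norm y / 2" .
    moreover have "norm (c *\<^sub>R x) \<le> K * norm y"
      using mult_left_mono[OF x(2), of c] c r by (simp add: K_def c_def field_simps)
    ultimately show ?thesis using x subspace_scale[OF S(2)] by blast
  qed
  then obtain g where g: "\<And>y. g y \<in> S" "\<And>y. norm (g y) \<le> K * norm y"
    "\<And>y. norm (y - f (g y)) \<le> norm y / 2" by metis
  have "\<exists>x\<in>S. f x = y \<and> norm x \<le> (2 * K) * norm y" for y
  proof -
    \<comment> \<open>The part of \<open>y\<close> still to be hit after \<open>k\<close>
      corrections. It halves at each step, so the corrections form a series dominated by a geometric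
      one with sum \<open>2 * K * norm y\<close>.\<close>
    define res where "res = rec_nat y (\<lambda>_ z. z - f (g z))"
    have res: "res 0 = y" "\<And>k. res (Suc k) = res k - f (g (res k))" by (simp_all add: res_def)
    have nres: "norm (res k) \<le> norm y * (1/2)^k" for k
    proof (induction k)
      case (Suc k)
      then show ?case using g(3)[of "res k"] by (simp add: res(2))
    qed (simp add: res)
    have ng: "norm (g (res k)) \<le> K * norm y * (1/2)^k" for k
      using g(2)[of "res k"] mult_left_mono[OF nres[of k] K] by (simp add: mult.assoc)
    have geo: "(\<lambda>k. K * norm y * (1/2::real)^k) sums (K * norm y * 2)"
      using sums_mult[OF geometric_sums[of "1/2::real"], of "K * norm y"] by simp
    have summ: "summable (\<lambda>k. norm (g (res k)))"
      by (rule summable_comparison_test'[OF sums_summable[OF geo], of 0]) (use ng in auto)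
    define x where "x = (\<Sum>k. g (res k))"
    have sx: "(\<lambda>n. \<Sum>k<n. g (res k)) \<longlonglongrightarrow> x"
      using summable_sums[OF summable_norm_cancel[OF summ]] by (simp add: sums_def x_def)
    have "x \<in> S"
      by (rule closed_sequentially[OF S(1) _ sx]) (auto intro: subspace_sum[OF S(2)] g(1))
    moreover have "norm x \<le> 2 * K * norm y"
      using summable_norm[OF summ] suminf_le[OF ng summ sums_summable[OF geo]] sums_unique[OF geo]
      by (simp add: x_def)
    moreover have "f x = y"
    proof (rule LIMSEQ_unique)
      show "(\<lambda>n. f (\<Sum>k<n. g (res k))) \<longlonglongrightarrow> f x" using sx by (rule f.tendsto)
      have eq: "f (\<Sum>k<n. g (res k)) = y - res n" for n
        by (induction n) (simp_all add: f.zero f.add res)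
      have "res \<longlonglongrightarrow> 0"
        by (rule Lim_null_comparison[of _ "\<lambda>k. norm y * (1/2)^k"])
          (auto simp: nres intro!: tendsto_mult_right_zero LIMSEQ_realpow_zero)
      then show "(\<lambda>n. f (\<Sum>k<n. g (res k))) \<longlonglongrightarrow> y"
        unfolding eq using tendsto_diff[OF tendsto_const[of y], of res 0] by simp
    qed
    ultimately show ?thesis by blast
  qed
  with K show thesis by (intro that[of "2 * K"]) auto
qed

section \<open>Strongly closed sets of operators\<close>

text \<open>The strong operator topology is the pullback of the product topology along
  \<open>blinfun_apply\<close>, so pointwise limits of sequences are limits in it.\<close>

lemma strongly_closed_limit:
  assumes "strongly_closed A" "T \<in> bounded_operators" "\<And>n::nat. a n \<in> A"
    and lim: "\<And>x. (\<lambda>n. blinfun_apply (a n) x) \<longlonglongrightarrow> blinfun_apply T x"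
  shows "T \<in> A"
proof -
  obtain C where C: "closedin strong_operator_topology C" "A = C \<inter> bounded_operators"
    using assms(1) unfolding strongly_closed_def closedin_subtopology by blast
  have op: "openin strong_operator_topology (- C)"
    using C(1) by (simp add: closedin_def strong_operator_topology_topspace Compl_eq_Diff_UNIV)
  then obtain U where U: "open U" "- C = blinfun_apply -` U"
    unfolding strong_operator_topology_def openin_pullback_topology by auto
  have "T \<in> C"
  proof (rule ccontr)
    assume "T \<notin> C"
    then have TU: "blinfun_apply T \<in> U" using U by auto
    have "limitin (product_topology (\<lambda>_. euclidean) UNIV) (\<lambda>n. blinfun_apply (a n)) (blinfun_apply T) sequentially"
      unfolding limitin_componentwise using lim by auto
    then have "(\<lambda>n. blinfun_apply (a n)) \<longlonglongrightarrow> blinfun_apply T"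
      by (simp add: euclidean_product_topology)
    then have "\<forall>\<^sub>F n in sequentially. blinfun_apply (a n) \<in> U"
      using U(1) TU by (rule topological_tendstoD)
    then obtain n where "blinfun_apply (a n) \<in> U" by (auto simp: eventually_sequentially)
    then show False using U assms(3)[of n] C by auto
  qed
  then show ?thesis using C assms by blast
qed

lemma bounded_operators_iff:
  "T \<in> bounded_operators \<longleftrightarrow> (\<forall>c x. blinfun_apply T (c *\<^sub>C x) = c *\<^sub>C blinfun_apply T x)"
  unfolding bounded_operators_def mem_Collect_eq
  by (subst Vector_Spaces.linear_iff)
    (auto simp: blinfun.add_right complex_vector.vector_space_axioms)

text \<open>Norm convergence implies pointwise convergence. Since strong closedness is relative to
  \<open>bounded_operators\<close>, complex linearity has to be passed to the limit first.\<close>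

lemma strongly_closed_imp_closed:
  assumes "strongly_closed A" "A \<subseteq> bounded_operators"
  shows "closed A"
  unfolding closed_sequential_limits
proof safe
  fix a T
  assume a: "\<forall>n. a n \<in> A" and lim: "a \<longlonglongrightarrow> T"
  have ptw: "(\<lambda>n. blinfun_apply (a n) x) \<longlonglongrightarrow> blinfun_apply T x" for x
    using lim by (intro tendsto_intros)
  have "blinfun_apply T (c *\<^sub>C x) = c *\<^sub>C blinfun_apply T x" for c x
  proof (rule LIMSEQ_unique[OF ptw])
    have "(\<lambda>n. c *\<^sub>C blinfun_apply (a n) x) \<longlonglongrightarrow> c *\<^sub>C blinfun_apply T x"
      using ptw by (rule bounded_linear.tendsto[OF bounded_linear_scaleC])
    moreover have "blinfun_apply (a n) (c *\<^sub>C x) = c *\<^sub>C blinfun_apply (a n) x" for n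
      using a assms(2) by (auto simp: bounded_operators_iff subset_iff)
    ultimately show "(\<lambda>n. blinfun_apply (a n) (c *\<^sub>C x)) \<longlonglongrightarrow> c *\<^sub>C blinfun_apply T x" by simp
  qed
  then show "T \<in> A"
    using strongly_closed_limit[OF assms(1) _ _ ptw] a by (auto simp: bounded_operators_iff)
qed

section \<open>Ideals of closed abelian algebras\<close>

lemma csubspace_closure:
  fixes I :: "'b::complex_normed_vector set"
  assumes sub: "csubspace I"
  shows "csubspace (closure I)"
proof (rule complex_vector.subspaceI)
  show "0 \<in> closure I"
    using complex_vector.subspace_0[OF sub] closure_subset by blast
  fix x y assume "x \<in> closure I" "y \<in> closure I"
  then obtain s t where st: "\<And>n. s n \<in> I" "s \<longlonglongrightarrow> x" "\<And>n. t n \<in> I" "t \<longlonglongrightarrow> y"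
    unfolding closure_sequential by blast
  show "x + y \<in> closure I"
    unfolding closure_sequential
    by (intro exI[of _ "\<lambda>n. s n + t n"] conjI allI tendsto_add st complex_vector.subspace_add[OF sub])
next
  fix c x assume "x \<in> closure I"
  then obtain s where s: "\<And>n. s n \<in> I" "s \<longlonglongrightarrow> x"
    unfolding closure_sequential by blast
  show "c *\<^sub>C x \<in> closure I"
    unfolding closure_sequential
    by (intro exI[of _ "\<lambda>n. c *\<^sub>C s n"] conjI allI complex_vector.subspace_scale[OF sub] s
        bounded_linear.tendsto[OF bounded_linear_scaleC])
qed

lemmas compose_simps =
  bounded_bilinear.add_left[OF bounded_bilinear_blinfun_compose]
  bounded_bilinear.add_right[OF bounded_bilinear_blinfun_compose]
  bounded_bilinear.diff_left[OF bounded_bilinear_blinfun_compose]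
  bounded_bilinear.diff_right[OF bounded_bilinear_blinfun_compose]

lemma compose_assoc: "(a o\<^sub>L b) o\<^sub>L c = a o\<^sub>L (b o\<^sub>L c)"
  by (rule blinfun_eqI) simp

lemma compose_id_left: "id_blinfun o\<^sub>L b = b"
  by (rule blinfun_eqI) simp

lemma compose_id_right: "b o\<^sub>L id_blinfun = b"
  by (rule blinfun_eqI) simp

text \<open>Norm closedness makes \<open>A\<close> complete, so this is the setting of commutative
  unital Banach algebras.\<close>

locale closed_abelian_algebra =
  fixes A :: "('a::complex_banach \<Rightarrow>\<^sub>L 'a) set"
  assumes algebra: "operator_algebra A" and abel: "abelian A" and unit: "unital A"
    and closed: "closed A"
begin

lemma mult_closed: "a \<in> A \<Longrightarrow> b \<in> A \<Longrightarrow> a o\<^sub>L b \<in> A"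
  using algebra by (simp add: operator_algebra_def)

lemma commute: "a \<in> A \<Longrightarrow> b \<in> A \<Longrightarrow> a o\<^sub>L b = b o\<^sub>L a"
  using abel by (simp add: abelian_def)

lemma one_closed: "id_blinfun \<in> A"
  using unit by (simp add: unital_def)

lemma csubspace: "csubspace A"
  using algebra by (simp add: operator_algebra_def)

lemma apply_scaleC: "a \<in> A \<Longrightarrow> blinfun_apply a (c *\<^sub>C x) = c *\<^sub>C blinfun_apply a x"
  using algebra by (auto simp: operator_algebra_def bounded_operators_iff subset_iff)

lemmas A_closed = mult_closed one_closed complex_vector.subspace_add[OF csubspace]
  complex_vector.subspace_diff[OF csubspace] complex_vector.subspace_scale[OF csubspace]
  complex_vector.subspace_neg[OF csubspace] complex_vector.subspace_0[OF csubspace]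

lemma algebra_idealI:
  assumes "I \<subseteq> A" "csubspace I" "\<And>a b. a \<in> A \<Longrightarrow> b \<in> I \<Longrightarrow> a o\<^sub>L b \<in> I"
  shows "algebra_ideal A I"
  unfolding algebra_ideal_def using assms commute by (metis subsetD)

lemma closure_ideal:
  assumes I: "algebra_ideal A I"
  shows "algebra_ideal A (closure I)"
proof (rule algebra_idealI)
  show "closure I \<subseteq> A"
    using I closed by (intro closure_minimal) (auto simp: algebra_ideal_def)
  have lim: "x \<in> closure I \<longleftrightarrow> (\<exists>s. (\<forall>n. s n \<in> I) \<and> s \<longlonglongrightarrow> x)" for x
    by (rule closure_sequential)
  show "csubspace (closure I)"
    using I by (intro csubspace_closure) (simp add: algebra_ideal_def)
  fix a b assume a: "a \<in> A" and "b \<in> closure I"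
  then obtain s where s: "\<And>n. s n \<in> I" "s \<longlonglongrightarrow> b" unfolding lim by blast
  have "(\<lambda>n. a o\<^sub>L s n) \<longlonglongrightarrow> (a o\<^sub>L b)"
    using s(2) by (intro tendsto_intros bounded_bilinear.tendsto[OF bounded_bilinear_blinfun_compose])
  moreover have "a o\<^sub>L s n \<in> I" for n using I a s(1) by (simp add: algebra_ideal_def)
  ultimately show "a o\<^sub>L b \<in> closure I"
    unfolding lim by (intro exI[of _ "\<lambda>n. a o\<^sub>L s n"]) simp
qed

lemma ideal_eq_algebra:
  assumes "algebra_ideal A I" "id_blinfun \<in> I"
  shows "I = A"
proof -
  have "a \<in> I" if "a \<in> A" for a
  proof -
    have "a o\<^sub>L id_blinfun \<in> I" using assms that unfolding algebra_ideal_def by blast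
    then show ?thesis by (simp add: compose_id_right)
  qed
  then show ?thesis using assms by (auto simp: algebra_ideal_def)
qed

text \<open>The inverse of \<open>1 - b\<close> is the fixed point of the contraction \<open>x \<mapsto> 1 + b x\<close>.\<close>

lemma inverse_near_one:
  assumes b: "b \<in> A" "norm b < 1"
  obtains x where "x \<in> A" "(id_blinfun - b) o\<^sub>L x = id_blinfun"
proof -
  have "\<exists>!x. x \<in> A \<and> id_blinfun + (b o\<^sub>L x) = x"
  proof (rule Banach_fix)
    show "complete A" using closed by (simp add: complete_eq_closed)
    show "A \<noteq> {}" using one_closed by blast
    show "(\<lambda>x. id_blinfun + (b o\<^sub>L x)) ` A \<subseteq> A" using b by (auto intro: A_closed)
    show "dist (id_blinfun + (b o\<^sub>L x)) (id_blinfun + (b o\<^sub>L y)) \<le> norm b * dist x y"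
      if "x \<in> A" "y \<in> A" for x y
      using norm_blinfun_compose[of b "x - y"]
      by (simp add: dist_norm compose_simps)
  qed (use b in auto)
  then obtain x where "x \<in> A" "id_blinfun + (b o\<^sub>L x) = x" by blast
  then have "(id_blinfun - b) o\<^sub>L x = id_blinfun"
    unfolding compose_simps
    by (metis add_diff_cancel_right' compose_id_left)
  then show thesis using that \<open>x \<in> A\<close> by blast
qed

text \<open>An element of \<open>I\<close> at distance less than 1 from the identity would be
  invertible in \<open>A\<close>, which forces \<open>I = A\<close>.\<close>

lemma closure_proper_ideal:
  assumes I: "algebra_ideal A I" "I \<noteq> A"
  shows "id_blinfun \<notin> closure I"
proof
  assume "id_blinfun \<in> closure I"
  then obtain m where m: "m \<in> I" "norm (id_blinfun - m) < 1"
    unfolding closure_approachable by (metis dist_commute dist_norm zero_less_one)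
  have mA: "m \<in> A" using I m by (auto simp: algebra_ideal_def)
  obtain x where x: "x \<in> A" "(id_blinfun - (id_blinfun - m)) o\<^sub>L x = id_blinfun"
    using inverse_near_one[of "id_blinfun - m"] m mA by (auto intro: A_closed)
  have "m o\<^sub>L x \<in> I" using I(1) m(1) x(1) unfolding algebra_ideal_def by blast
  moreover have "m o\<^sub>L x = id_blinfun" using x(2) by simp
  ultimately show False using ideal_eq_algebra[OF I(1)] I(2) by simp
qed

text \<open>The closure is again a proper ideal, so by maximality it adds nothing.\<close>

lemma maximal_ideal_closed:
  assumes "maximal_algebra_ideal A M"
  shows "closed M"
proof -
  have M: "algebra_ideal A M" "M \<noteq> A" "\<And>J. algebra_ideal A J \<Longrightarrow> M \<subseteq> J \<Longrightarrow> J = M \<or> J = A"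
    using assms by (auto simp: maximal_algebra_ideal_def)
  have "closure M \<noteq> A" using closure_proper_ideal[OF M(1,2)] one_closed by blast
  then have "closure M = M" using M(3)[OF closure_ideal[OF M(1)] closure_subset] by blast
  then show ?thesis by (metis closed_closure)
qed

text \<open>The quotient by a maximal ideal is a field: the ideal \<open>J\<close>, generated by
  \<open>M\<close> and \<open>a\<close>, is strictly larger than \<open>M\<close> and therefore
  contains the identity.\<close>

lemma maximal_ideal_inverse:
  assumes max: "maximal_algebra_ideal A M" and a: "a \<in> A" "a \<notin> M"
  obtains b where "b \<in> A" "(a o\<^sub>L b) - id_blinfun \<in> M"
proof -
  have M: "algebra_ideal A M" "\<And>J. algebra_ideal A J \<Longrightarrow> M \<subseteq> J \<Longrightarrow> J = M \<or> J = A"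
    using max by (auto simp: maximal_algebra_ideal_def)
  have sub: "csubspace M" and MA: "M \<subseteq> A"
    and Mmult: "\<And>a b. a \<in> A \<Longrightarrow> b \<in> M \<Longrightarrow> a o\<^sub>L b \<in> M"
    using M(1) by (simp_all add: algebra_ideal_def)
  define J where "J = {m + (a o\<^sub>L b) | m b. m \<in> M \<and> b \<in> A}"
  have "algebra_ideal A J"
  proof (rule algebra_idealI)
    show "J \<subseteq> A" using MA a by (auto simp: J_def intro: A_closed)
    show "csubspace J"
    proof (rule complex_vector.subspaceI)
      show "0 \<in> J" unfolding J_def
        using complex_vector.subspace_0[OF sub] complex_vector.subspace_0[OF csubspace]
        by (intro CollectI exI[of _ 0]) simp
    next
      fix x y assume "x \<in> J" "y \<in> J"
      then obtain m b n c where "x = m + (a o\<^sub>L b)" "y = n + (a o\<^sub>L c)" "m \<in> M" "n \<in> M" "b \<in> A" "c \<in> A"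
        by (auto simp: J_def)
      moreover from this have "x + y = (m + n) + (a o\<^sub>L (b + c))"
        by (simp add: compose_simps)
      ultimately show "x + y \<in> J"
        unfolding J_def using complex_vector.subspace_add[OF sub] A_closed(3) by blast
    next
      fix k x assume "x \<in> J"
      then obtain m b where "x = m + (a o\<^sub>L b)" "m \<in> M" "b \<in> A"
        by (auto simp: J_def)
      moreover from this have "k *\<^sub>C x = k *\<^sub>C m + (a o\<^sub>L (k *\<^sub>C b))"
        using a by (intro blinfun_eqI) (simp add: blinfun.bilinear_simps blinfun_apply_scaleC apply_scaleC scaleC_add_right)
      ultimately show "k *\<^sub>C x \<in> J"
        unfolding J_def using complex_vector.subspace_scale[OF sub] A_closed(5) by blast
    qed
    fix c x assume c: "c \<in> A" and "x \<in> J"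
    then obtain m b where x: "x = m + (a o\<^sub>L b)" "m \<in> M" "b \<in> A"
      by (auto simp: J_def)
    have "c o\<^sub>L x = (c o\<^sub>L m) + ((c o\<^sub>L a) o\<^sub>L b)"
      by (simp add: x compose_simps compose_assoc)
    also have "c o\<^sub>L a = a o\<^sub>L c" using c a by (simp add: commute)
    also have "(a o\<^sub>L c) o\<^sub>L b = a o\<^sub>L (c o\<^sub>L b)" by (rule compose_assoc)
    finally show "c o\<^sub>L x \<in> J" unfolding J_def using Mmult[OF c x(2)] mult_closed[OF c x(3)] by blast
  qed
  moreover have "M \<subseteq> J"
  proof
    fix m assume "m \<in> M"
    then show "m \<in> J" unfolding J_def using complex_vector.subspace_0[OF csubspace]
      by (intro CollectI exI[of _ m] exI[of _ 0]) simp
  qed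
  moreover have "a \<in> J" unfolding J_def
    using complex_vector.subspace_0[OF sub] one_closed
    by (intro CollectI exI[of _ 0] exI[of _ id_blinfun]) (simp add: compose_id_right)
  ultimately have "id_blinfun \<in> J" using M(2) a one_closed by blast
  then obtain m b where mb: "m \<in> M" "b \<in> A" "id_blinfun = m + (a o\<^sub>L b)" by (auto simp: J_def)
  have "(a o\<^sub>L b) - id_blinfun = - m" by (subst mb(3)) simp
  then show thesis using that[OF mb(2)] complex_vector.subspace_neg[OF sub mb(1)] by simp
qed

end

section \<open>The Gelfand--Mazur theorem\<close>

text \<open>The quotient \<open>A / M\<close> is not formed as a type; its equations are expressed
  by differences lying in \<open>M\<close>.\<close>

locale closed_ideal = closed_abelian_algebra A for A :: "('a::complex_banach \<Rightarrow>\<^sub>L 'a) set" +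
  fixes M
  assumes ideal: "algebra_ideal A M" and closed_ideal: "closed M"
begin

lemma ideal_subset: "m \<in> M \<Longrightarrow> m \<in> A"
  and ideal_csubspace: "csubspace M"
  and ideal_mult: "a \<in> A \<Longrightarrow> m \<in> M \<Longrightarrow> a o\<^sub>L m \<in> M" "a \<in> A \<Longrightarrow> m \<in> M \<Longrightarrow> m o\<^sub>L a \<in> M"
  using ideal by (auto simp: algebra_ideal_def)

lemmas M_closed = ideal_mult complex_vector.subspace_add[OF ideal_csubspace]
  complex_vector.subspace_diff[OF ideal_csubspace] complex_vector.subspace_scale[OF ideal_csubspace]
  complex_vector.subspace_neg[OF ideal_csubspace] complex_vector.subspace_0[OF ideal_csubspace]

text \<open>The norm of the quotient algebra \<open>A / M\<close>, lifted to \<open>A\<close>.\<close>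

definition q :: "('a \<Rightarrow>\<^sub>L 'a) \<Rightarrow> real"
  where "q b = infdist b M"

lemma q_nonneg [simp]: "0 \<le> q b"
  by (simp add: q_def infdist_nonneg)

text \<open>The distance to \<open>M\<close> need not be attained, so estimates on \<open>q\<close>
  use representatives that come within an arbitrary \<open>e\<close> of it.\<close>

lemma q_less_iff: "q b < e \<longleftrightarrow> (\<exists>m\<in>M. norm (b - m) < e)"
proof -
  have "M \<noteq> {}" using M_closed(7) by blast
  then show ?thesis
    unfolding q_def by (subst infdist_notempty, assumption, subst cINF_less_iff) (auto simp: dist_norm intro!: bdd_belowI2[of _ 0])
qed

lemma q_le_norm: "q b \<le> norm b"
  using infdist_le[OF M_closed(7), of b] by (simp add: q_def)

lemma q_eq_0_iff: "q b = 0 \<longleftrightarrow> b \<in> M"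
  using in_closed_iff_infdist_zero[OF closed_ideal, of b] M_closed(7) by (auto simp: q_def)

lemma q_one_le: "q id_blinfun \<le> 1"
  using q_le_norm[of id_blinfun] norm_blinfun_id_le order_trans by blast

lemma q_add_le: "q (a + b) \<le> q a + q b"
proof (rule field_le_epsilon)
  fix e :: real assume "e > 0"
  then have "q a < q a + e / 2" "q b < q b + e / 2" by auto
  then obtain m n where m: "m \<in> M" "norm (a - m) < q a + e / 2"
    and n: "n \<in> M" "norm (b - n) < q b + e / 2" unfolding q_less_iff by blast
  have "(a + b) - (m + n) = (a - m) + (b - n)" by simp
  then have "norm ((a + b) - (m + n)) < q a + q b + e"
    using norm_triangle_ineq[of "a - m" "b - n"] m n by (simp only:)
  then have "q (a + b) < q a + q b + e" using M_closed(3)[OF m(1) n(1)] q_less_iff by blast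
  then show "q (a + b) \<le> q a + q b + e" by simp
qed

lemma q_cong: "a - b \<in> M \<Longrightarrow> q a = q b"
  using q_add_le[of "a - b" b] q_add_le[of "- (a - b)" a] M_closed(6)[of "a - b"]
    q_eq_0_iff[of "a - b"] q_eq_0_iff[of "- (a - b)"]
  by simp

lemma q_scale_le: "q (c *\<^sub>C b) \<le> cmod c * q b"
proof (rule field_le_epsilon)
  fix e :: real assume e: "e > 0"
  define d where "d = e / (cmod c + 1)"
  have d: "d > 0" "cmod c * d \<le> e"
    using e norm_ge_zero[of c] by (simp_all add: d_def field_simps add_pos_nonneg add_nonneg_pos)
  then have "q b < q b + d" by simp
  then obtain m where m: "m \<in> M" "norm (b - m) < q b + d" unfolding q_less_iff by blast
  have "q (c *\<^sub>C b) \<le> norm (c *\<^sub>C b - c *\<^sub>C m)"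
    unfolding q_def dist_norm[symmetric] by (intro infdist_le M_closed(5) m)
  also have "\<dots> = cmod c * norm (b - m)"
    by (simp add: norm_scaleC flip: complex_vector.scale_right_diff_distrib)
  also have "\<dots> \<le> cmod c * (q b + d)" using m by (intro mult_left_mono) auto
  finally show "q (c *\<^sub>C b) \<le> cmod c * q b + e" using d by (simp add: algebra_simps)
qed

lemma q_scale: "q (c *\<^sub>C b) = cmod c * q b"
proof (cases "c = 0")
  case True
  then show ?thesis using q_eq_0_iff[of 0] M_closed(7) by simp
next
  case False
  then have "q b \<le> inverse (cmod c) * q (c *\<^sub>C b)"
    using q_scale_le[of "inverse c" "c *\<^sub>C b"] by (simp add: norm_inverse)
  then have "cmod c * q b \<le> q (c *\<^sub>C b)" using False by (simp add: field_simps)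
  then show ?thesis using q_scale_le[of c b] by simp
qed

lemma q_minus [simp]: "q (- b) = q b"
  using q_scale[of "-1" b] by (simp add: complex_vector.scale_minus_left)

text \<open>The products of \<open>a - m\<close> and \<open>b - n\<close> and of \<open>a\<close>
  and \<open>b\<close> agree modulo \<open>M\<close>, so nearly optimal representatives of the
  factors give a representative of the product. The slack \<open>e\<close> then tends to 0.\<close>

lemma q_mult_le:
  assumes ab: "a \<in> A" "b \<in> A"
  shows "q (a o\<^sub>L b) \<le> q a * q b"
proof (rule tendsto_lowerbound)
  show "((\<lambda>e. (q a + e) * (q b + e)) \<longlongrightarrow> q a * q b) (at_right 0)"
    by (auto intro!: tendsto_eq_intros)
  show "\<forall>\<^sub>F e in at_right 0. q (a o\<^sub>L b) \<le> (q a + e) * (q b + e)"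
  proof (rule eventually_at_right_less[THEN eventually_mono])
    fix e :: real assume "0 < e"
    then have "q a < q a + e" "q b < q b + e" by auto
    then obtain m n where m: "m \<in> M" "norm (a - m) < q a + e"
      and n: "n \<in> M" "norm (b - n) < q b + e" unfolding q_less_iff by blast
    have "(a o\<^sub>L b) - ((a - m) o\<^sub>L (b - n)) \<in> M"
    proof -
      have "(a o\<^sub>L b) - ((a - m) o\<^sub>L (b - n)) = (a o\<^sub>L n) + (m o\<^sub>L b) - (m o\<^sub>L n)"
        by (simp add: compose_simps)
      then show ?thesis using ab m n ideal_subset by (auto intro: M_closed)
    qed
    then have "q (a o\<^sub>L b) = q ((a - m) o\<^sub>L (b - n))" by (rule q_cong)
    also have "\<dots> \<le> norm (a - m) * norm (b - n)"
      by (rule order_trans[OF q_le_norm norm_blinfun_compose])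
    also have "\<dots> \<le> (q a + e) * (q b + e)"
      using m n \<open>0 < e\<close> by (intro mult_mono) (auto intro: add_nonneg_nonneg)
    finally show "q (a o\<^sub>L b) \<le> (q a + e) * (q b + e)" .
  qed
qed simp

section \<open>Resolvents modulo a closed ideal\<close>

lemma compose_scaleC_left: "(c *\<^sub>C a) o\<^sub>L b = c *\<^sub>C (a o\<^sub>L b)"
  by (rule blinfun_eqI) (simp add: blinfun_apply_scaleC)

lemma compose_scaleC_right: "a \<in> A \<Longrightarrow> a o\<^sub>L (c *\<^sub>C b) = c *\<^sub>C (a o\<^sub>L b)"
  by (rule blinfun_eqI) (simp add: blinfun_apply_scaleC apply_scaleC)

text \<open>The resolvent identity \<open>x - y = (z - w) a x y\<close> modulo \<open>M\<close>,
  where \<open>x\<close> and \<open>y\<close> represent the inverses of \<open>1 - z a\<close> and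
  \<open>1 - w a\<close>.\<close>

lemma resolvent_difference:
  assumes A: "a \<in> A" "x \<in> A" "y \<in> A"
    and x: "((id_blinfun - z *\<^sub>C a) o\<^sub>L x) - id_blinfun \<in> M"
    and y: "((id_blinfun - w *\<^sub>C a) o\<^sub>L y) - id_blinfun \<in> M"
  shows "q (x - y) \<le> cmod (z - w) * (q a * (q x * q y))"
proof -
  have c: "y o\<^sub>L x = x o\<^sub>L y" "y o\<^sub>L (a o\<^sub>L x) = a o\<^sub>L (x o\<^sub>L y)" "x o\<^sub>L (a o\<^sub>L y) = a o\<^sub>L (x o\<^sub>L y)"
    using A by (metis commute compose_assoc)+
  have "(x - y) - (z - w) *\<^sub>C (a o\<^sub>L (x o\<^sub>L y)) =
      (y o\<^sub>L (((id_blinfun - z *\<^sub>C a) o\<^sub>L x) - id_blinfun)) -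
      (x o\<^sub>L (((id_blinfun - w *\<^sub>C a) o\<^sub>L y) - id_blinfun))"
    using A
    by (simp add: compose_simps compose_id_left compose_id_right compose_scaleC_left
        compose_scaleC_right c complex_vector.scale_left_diff_distrib)
  also have "\<dots> \<in> M" by (intro M_closed A x y)
  finally have "q (x - y) = cmod (z - w) * q (a o\<^sub>L (x o\<^sub>L y))"
    unfolding q_scale[symmetric] by (rule q_cong)
  also have "q (a o\<^sub>L (x o\<^sub>L y)) \<le> q a * q (x o\<^sub>L y)" using A by (intro q_mult_le A_closed)
  also have "q (x o\<^sub>L y) \<le> q x * q y" using A by (intro q_mult_le)
  finally show ?thesis by (simp add: mult_left_mono)
qed

text \<open>\<open>1 / (1 - b\<^sup>2)\<close> is the mean of \<open>1 / (1 - b)\<close> and \<open>1 / (1 + b)\<close>.\<close>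

lemma resolvent_square:
  assumes A: "b \<in> A" "g \<in> A" "h \<in> A"
    and g: "((id_blinfun - b) o\<^sub>L g) - id_blinfun \<in> M"
    and h: "((id_blinfun + b) o\<^sub>L h) - id_blinfun \<in> M"
  shows "((id_blinfun - (b o\<^sub>L b)) o\<^sub>L ((1/2) *\<^sub>C (g + h))) - id_blinfun \<in> M"
proof -
  have e: "id_blinfun - (b o\<^sub>L b) \<in> A" "id_blinfun + b \<in> A" "id_blinfun - b \<in> A"
    using A by (auto intro: A_closed)
  have half: "id_blinfun = (1/2::complex) *\<^sub>C ((id_blinfun :: 'a \<Rightarrow>\<^sub>L 'a) + id_blinfun)"
    using complex_vector.scale_left_distrib[of "1/2" "1/2" "id_blinfun :: 'a \<Rightarrow>\<^sub>L 'a"]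
    by (simp add: scaleC_add_right)
  have "((id_blinfun - (b o\<^sub>L b)) o\<^sub>L ((1/2) *\<^sub>C (g + h))) - id_blinfun =
      (1/2) *\<^sub>C (((id_blinfun - (b o\<^sub>L b)) o\<^sub>L (g + h)) - (id_blinfun + id_blinfun))"
    using e(1) half by (simp add: compose_scaleC_right complex_vector.scale_right_diff_distrib)
  \<comment> \<open>Both factorisations of \<open>1 - b b\<close> into \<open>1 + b\<close> and
    \<open>1 - b\<close> are used; the subtracted terms add up to
    \<open>(1 + b) + (1 - b) = 2\<close>.\<close>
  also have "((id_blinfun - (b o\<^sub>L b)) o\<^sub>L (g + h)) - (id_blinfun + id_blinfun) =
      ((id_blinfun + b) o\<^sub>L (((id_blinfun - b) o\<^sub>L g) - id_blinfun)) +
      ((id_blinfun - b) o\<^sub>L (((id_blinfun + b) o\<^sub>L h) - id_blinfun))"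
    by (simp add: compose_simps compose_assoc compose_id_left compose_id_right)
  also have "(1/2) *\<^sub>C \<dots> \<in> M" by (intro M_closed e g h)
  finally show ?thesis .
qed

text \<open>The power of \<open>b\<close> with exponent \<open>2 ^ n\<close>. Passing from one such
  power to the next needs only a mean of two resolvents.\<close>

abbreviation sq :: "nat \<Rightarrow> ('a \<Rightarrow>\<^sub>L 'a) \<Rightarrow> ('a \<Rightarrow>\<^sub>L 'a)"
  where "sq n \<equiv> (\<lambda>b. b o\<^sub>L b) ^^ n"

lemma sq_closed: "a \<in> A \<Longrightarrow> sq n a \<in> A"
  by (induction n) (auto intro: A_closed)

lemma q_sq_le: "a \<in> A \<Longrightarrow> q (sq n a) \<le> q a ^ (2 ^ n)"
proof (induction n)
  case (Suc n)
  have "q (sq (Suc n) a) \<le> q (sq n a) * q (sq n a)"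
    using q_mult_le[OF sq_closed sq_closed] Suc.prems by simp
  also have "\<dots> \<le> q a ^ (2 ^ n) * q a ^ (2 ^ n)" using Suc by (intro mult_mono) auto
  also have "\<dots> = q a ^ (2 ^ Suc n)" by (simp flip: power_add add: mult_2)
  finally show ?case .
qed simp

lemma sq_inverse:
  assumes "a \<in> A" "b \<in> A" "(a o\<^sub>L b) - id_blinfun \<in> M"
  shows "(sq n a o\<^sub>L sq n b) - id_blinfun \<in> M"
proof (induction n)
  case (Suc n)
  let ?x = "sq n a" and ?y = "sq n b"
  have xy: "?x \<in> A" "?y \<in> A" using assms sq_closed by auto
  have c: "?x o\<^sub>L (?y o\<^sub>L ?y) = ?y o\<^sub>L (?x o\<^sub>L ?y)"
    unfolding compose_assoc[symmetric] by (simp only: commute[OF xy])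
  have "((?x o\<^sub>L ?x) o\<^sub>L (?y o\<^sub>L ?y)) - id_blinfun =
      ((?x o\<^sub>L ?y) o\<^sub>L ((?x o\<^sub>L ?y) - id_blinfun)) + ((?x o\<^sub>L ?y) - id_blinfun)"
    by (simp add: compose_simps compose_assoc compose_id_right c)
  also have "\<dots> \<in> M" by (intro M_closed(1,3) A_closed(1) xy Suc.IH Suc.prems)
  finally show ?case by simp
qed (use assms in simp)

text \<open>The function \<open>g\<close> is the mean of \<open>f\<close> over the points
  \<open>\<omega> * z\<close>, where \<omega> runs through the roots of unity of order
  \<open>2 ^ n\<close>. Rotations preserve the disc and its distances, and averaging does not
  increase Lipschitz constants, so the same \<open>L\<close> serves for every
  \<open>n\<close>.\<close>

lemma iterated_mean:
  assumes a: "a \<in> A"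
    and f: "\<And>z. f z \<in> A" "\<And>z. ((id_blinfun - z *\<^sub>C a) o\<^sub>L f z) - id_blinfun \<in> M"
    and lip: "\<And>z w. cmod z \<le> R \<Longrightarrow> cmod w \<le> R \<Longrightarrow> q (f z - f w) \<le> L * cmod (z - w)"
  shows "\<exists>g. (\<forall>z. g z \<in> A \<and> ((id_blinfun - z ^ (2 ^ n) *\<^sub>C sq n a) o\<^sub>L g z) - id_blinfun \<in> M) \<and>
    (\<forall>z w. cmod z \<le> R \<longrightarrow> cmod w \<le> R \<longrightarrow> q (g z - g w) \<le> L * cmod (z - w))"
proof (induction n)
  case 0
  show ?case using f lip by (intro exI[of _ f]) simp
next
  case (Suc n)
  then obtain g where g: "\<And>z. g z \<in> A"
      "\<And>z. ((id_blinfun - z ^ (2 ^ n) *\<^sub>C sq n a) o\<^sub>L g z) - id_blinfun \<in> M"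
    and g_lip: "\<And>z w. cmod z \<le> R \<Longrightarrow> cmod w \<le> R \<Longrightarrow> q (g z - g w) \<le> L * cmod (z - w)"
    by blast
  \<comment> \<open>Since the power of \<zeta> with exponent \<open>2 ^ n\<close> is -1, replacing
    \<open>z\<close> by \<open>\<zeta> * z\<close> changes the sign of
    \<open>z ^ (2 ^ n) *\<^sub>C sq n a\<close>; \<open>resolvent_square\<close> then combines the
    two resolvents.\<close>
  define \<zeta> where "\<zeta> = cis (pi / 2 ^ n)"
  have "\<zeta> ^ (2 ^ n) = cis (real (2 ^ n) * (pi / 2 ^ n))"
    unfolding \<zeta>_def by (rule Complex.DeMoivre)
  also have "real (2 ^ n) * (pi / 2 ^ n) = pi" by simp
  finally have \<zeta>: "\<zeta> ^ (2 ^ n) = -1" "cmod \<zeta> = 1"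
    by (simp_all add: \<zeta>_def)
  define h where "h z = (1/2) *\<^sub>C (g z + g (\<zeta> * z))" for z
  have "h z \<in> A" for z
    unfolding h_def by (intro A_closed g)
  moreover have "((id_blinfun - z ^ (2 ^ Suc n) *\<^sub>C sq (Suc n) a) o\<^sub>L h z) - id_blinfun \<in> M" for z
  proof -
    define b where "b = z ^ (2 ^ n) *\<^sub>C sq n a"
    have b: "b \<in> A" using a by (auto simp: b_def intro: A_closed sq_closed)
    have "b o\<^sub>L b = z ^ (2 ^ Suc n) *\<^sub>C sq (Suc n) a"
      using sq_closed[OF a, of n]
      by (simp add: b_def compose_scaleC_left compose_scaleC_right mult_2 power_add)
    moreover have "((id_blinfun + b) o\<^sub>L g (\<zeta> * z)) - id_blinfun \<in> M"
      using g(2)[of "\<zeta> * z"] by (simp add: b_def power_mult_distrib \<zeta> complex_vector.scale_minus_left)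
    ultimately show ?thesis
      using resolvent_square[OF b g(1) g(1), of z "\<zeta> * z"] g(2)[of z] by (simp add: h_def b_def)
  qed
  moreover have "q (h z - h w) \<le> L * cmod (z - w)" if "cmod z \<le> R" "cmod w \<le> R" for z w
  proof -
    have "h z - h w = (1/2) *\<^sub>C ((g z - g w) + (g (\<zeta> * z) - g (\<zeta> * w)))"
      by (simp add: h_def scaleC_add_right complex_vector.scale_right_diff_distrib)
    then have "q (h z - h w) = 1/2 * q ((g z - g w) + (g (\<zeta> * z) - g (\<zeta> * w)))"
      by (simp add: q_scale)
    also have "\<dots> \<le> 1/2 * (L * cmod (z - w) + L * cmod (\<zeta> * z - \<zeta> * w))"
      using that \<zeta> by (intro mult_left_mono order_trans[OF q_add_le add_mono] g_lip) (auto simp: norm_mult)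
    also have "cmod (\<zeta> * z - \<zeta> * w) = cmod (z - w)"
      using \<zeta> by (simp add: norm_mult flip: right_diff_distrib)
    finally show ?thesis by simp
  qed
  ultimately show ?case by blast
qed

text \<open>The function \<open>f\<close> is merely a choice of representatives, but
  \<open>resolvent_difference\<close> bounds \<open>q (f z)\<close> near each \<open>w\<close>, and
  compactness of the disc makes the bound uniform.\<close>

lemma resolvent_bounded:
  assumes a: "a \<in> A"
    and f: "\<And>z. f z \<in> A" "\<And>z. ((id_blinfun - z *\<^sub>C a) o\<^sub>L f z) - id_blinfun \<in> M"
  obtains B where "B \<ge> 0" "\<And>z. cmod z \<le> R \<Longrightarrow> q (f z) \<le> B"
proof -
  \<comment> \<open>Chosen so that \<open>cmod (z - w) * (q a * q (f w))\<close> is at most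
    \<open>1/2\<close> on the ball. Then \<open>q (f z) \<le> q (f w) + q (f z) / 2\<close>, and the
    last term can be absorbed. The summand 1 keeps the denominator positive.\<close>
  define d where "d w = 1 / (2 * (q a * q (f w) + 1))" for w
  have pos: "q a * q (f w) + 1 > 0" for w
    by (intro add_nonneg_pos mult_nonneg_nonneg) auto
  have d: "d w > 0" for w
    using pos[of w] by (simp add: d_def)
  have near: "q (f z) \<le> 2 * q (f w)" if "z \<in> ball w (d w)" for z w
  proof -
    have "cmod (z - w) * (q a * q (f w)) \<le> d w * (q a * q (f w) + 1)"
      using that d[of w] by (intro mult_mono) (auto simp: dist_norm norm_minus_commute)
    also have "\<dots> = 1 / 2" using pos[of w] by (simp add: d_def)
    finally have "cmod (z - w) * (q a * q (f w)) * q (f z) \<le> 1 / 2 * q (f z)"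
      by (intro mult_right_mono) auto
    then have "q (f z - f w) \<le> 1 / 2 * q (f z)"
      using resolvent_difference[OF a f(1) f(1) f(2) f(2), of z w] by (simp add: algebra_simps)
    then show ?thesis using q_add_le[of "f z - f w" "f w"] by simp
  qed
  have "cball 0 R \<subseteq> (\<Union>w\<in>UNIV. ball w (d w))"
  proof
    fix z :: complex
    show "z \<in> (\<Union>w\<in>UNIV. ball w (d w))" using d[of z] by (intro UN_I[of z]) auto
  qed
  then obtain D where D: "finite D" "cball 0 R \<subseteq> (\<Union>w\<in>D. ball w (d w))"
    using compactE_image[of "cball 0 R" UNIV "\<lambda>w. ball w (d w)"] by auto
  \<comment> \<open>A sum in place of a maximum also covers an empty \<open>D\<close>, which can
    occur for negative \<open>R\<close>.\<close>
  have "q (f z) \<le> (\<Sum>w\<in>D. 2 * q (f w))" if z: "cmod z \<le> R" for z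
  proof -
    obtain w where w: "w \<in> D" "z \<in> ball w (d w)" using D(2) z by auto
    show ?thesis
      using near[OF w(2)] member_le_sum[OF w(1), of "\<lambda>w. 2 * q (f w)"] D(1) by simp
  qed
  then show thesis by (intro that[of "\<Sum>w\<in>D. 2 * q (f w)"]) (auto intro: sum_nonneg)
qed

end

context closed_ideal begin

text \<open>
  The resolvent means stay close to \<open>1\<close> while the parameter moves by a fixed amount, so the
  radius \<open>r\<close> at which the powers of \<open>r a\<close> tend to \<open>0\<close> can be increased by that amount.
\<close>

lemma radius_extends:
  assumes a: "a \<in> A"
    and f: "\<And>z. f z \<in> A" "\<And>z. ((id_blinfun - z *\<^sub>C a) o\<^sub>L f z) - id_blinfun \<in> M"
    and lip: "\<And>z w. cmod z \<le> R \<Longrightarrow> cmod w \<le> R \<Longrightarrow> q (f z - f w) \<le> L * cmod (z - w)"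
    and r: "0 \<le> r" "r \<le> R" and s: "0 \<le> s" "s < t" "t \<le> R" and near: "L * \<bar>t - r\<bar> \<le> 1/4"
    and lim: "(\<lambda>n. r ^ (2 ^ n) * q (sq n a)) \<longlonglongrightarrow> 0"
  shows "(\<lambda>n. s ^ (2 ^ n) * q (sq n a)) \<longlonglongrightarrow> 0"
proof (rule Lim_null_comparison)
  have "\<forall>\<^sub>F n in sequentially. r ^ (2 ^ n) * q (sq n a) < 1/8"
    using order_tendstoD(2)[OF lim, of "1/8"] by simp
  then show "\<forall>\<^sub>F n in sequentially. norm (s ^ (2 ^ n) * q (sq n a)) \<le> 3 * (s / t) ^ n"
  proof (rule eventually_mono)
    fix n assume small: "r ^ (2 ^ n) * q (sq n a) < 1/8"
    obtain g where g: "\<And>z. g z \<in> A"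
        "\<And>z. ((id_blinfun - z ^ (2 ^ n) *\<^sub>C sq n a) o\<^sub>L g z) - id_blinfun \<in> M"
      and g_lip: "\<And>z w. cmod z \<le> R \<Longrightarrow> cmod w \<le> R \<Longrightarrow> q (g z - g w) \<le> L * cmod (z - w)"
      using iterated_mean[where n = n, OF a f lip] by blast
    define b where "b = complex_of_real r ^ (2 ^ n) *\<^sub>C sq n a"
    define c where "c = complex_of_real t ^ (2 ^ n) *\<^sub>C sq n a"
    define x where "x = g (complex_of_real r)"
    define y where "y = g (complex_of_real t)"
    have bc: "b \<in> A" "c \<in> A" using a by (auto simp: b_def c_def intro: A_closed sq_closed)
    have xy: "x \<in> A" "y \<in> A" using g by (auto simp: x_def y_def)
    have qb: "q b < 1/8"
      using small r by (simp add: b_def q_scale norm_power)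
    \<comment> \<open>At \<open>r\<close> the mean is near 1: modulo \<open>M\<close>,
      \<open>x - 1\<close> equals \<open>b x\<close>, and \<open>q b < 1/8\<close>.\<close>
    have "((id_blinfun - b) o\<^sub>L x) - id_blinfun \<in> M"
      using g(2)[of "complex_of_real r"] by (simp add: b_def x_def)
    then have "(x - id_blinfun) - (b o\<^sub>L x) \<in> M"
      by (simp add: compose_simps compose_id_left algebra_simps)
    then have "q (x - id_blinfun) = q (b o\<^sub>L x)" by (rule q_cong)
    also have "\<dots> \<le> q b * q x" using bc xy by (intro q_mult_le)
    also have "\<dots> \<le> 1/8 * q x" using qb by (intro mult_right_mono) auto
    finally have "q (x - id_blinfun) \<le> 1/8 * q x" .
    moreover have "q x \<le> q (x - id_blinfun) + 1"
      using q_add_le[of "x - id_blinfun" id_blinfun] q_one_le by simp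
    ultimately have x1: "q (x - id_blinfun) \<le> 1/4" by linarith
    \<comment> \<open>Moving from \<open>r\<close> to \<open>t\<close> costs at most
      \<open>1/4\<close>, by the Lipschitz constant that does not depend on
      \<open>n\<close>.\<close>
    have "q (y - x) \<le> L * \<bar>t - r\<bar>"
      using g_lip[of t r] r s by (simp add: x_def y_def flip: of_real_diff)
    then have "q (y - id_blinfun) \<le> 1/2"
      using q_add_le[of "y - x" "x - id_blinfun"] x1 near by simp
    then have y1: "q (id_blinfun - y) \<le> 1/2" using q_minus[of "y - id_blinfun"] by simp
    \<comment> \<open>As \<open>y\<close> is within \<open>1/2\<close> of 1 and inverts
      \<open>h\<close> modulo \<open>M\<close>, \<open>h\<close> stays at bounded distance from 1,
      which bounds \<open>c\<close>.\<close>
    define h where "h = id_blinfun - c"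
    have h: "h \<in> A" unfolding h_def using bc by (intro A_closed)
    have "(h o\<^sub>L y) - id_blinfun \<in> M"
      using g(2)[of "complex_of_real t"] by (simp add: c_def y_def h_def)
    moreover have "(h o\<^sub>L y) - id_blinfun = (h - id_blinfun) - (h o\<^sub>L (id_blinfun - y))"
      by (simp add: compose_simps compose_id_right)
    ultimately have "q (h - id_blinfun) = q (h o\<^sub>L (id_blinfun - y))"
      by (intro q_cong) simp
    also have "\<dots> \<le> q h * q (id_blinfun - y)" using h xy by (intro q_mult_le A_closed)
    also have "\<dots> \<le> q h * (1/2)" using y1 by (intro mult_left_mono) auto
    finally have "q (h - id_blinfun) \<le> q h * (1/2)" .
    moreover have "q h \<le> q (h - id_blinfun) + 1"
      using q_add_le[of "h - id_blinfun" id_blinfun] q_one_le by simp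
    ultimately have "q (h - id_blinfun) \<le> 3" by linarith
    then have "q c \<le> 3" by (simp add: h_def)
    then have 3: "t ^ (2 ^ n) * q (sq n a) \<le> 3"
      using s by (simp add: c_def q_scale norm_power)
    \<comment> \<open>At \<open>t\<close> there is only boundedness; the strict inequality
      \<open>s < t\<close> turns it into geometric decay.\<close>
    have "s ^ (2 ^ n) * q (sq n a) = (s / t) ^ (2 ^ n) * (t ^ (2 ^ n) * q (sq n a))"
      using s by (simp add: power_divide)
    also have "\<dots> \<le> (s / t) ^ n * 3"
      using s 3 by (intro mult_mono power_decreasing) (auto simp: less_imp_le[OF less_exp])
    finally show "norm (s ^ (2 ^ n) * q (sq n a)) \<le> 3 * (s / t) ^ n" using s by simp
  qed
  show "(\<lambda>n. 3 * (s / t) ^ n) \<longlonglongrightarrow> 0"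
    using s by (intro tendsto_mult_right_zero LIMSEQ_realpow_zero) auto
qed

end

section \<open>Maximal ideals have codimension one\<close>

context closed_abelian_algebra begin

text \<open>If \<open>a\<close> is congruent to no scalar, then every \<open>1 - z a\<close> is
  invertible modulo \<open>M\<close>, so \<open>radius_extends\<close> can be repeated up to the
  radius \<open>q a'\<close>, where \<open>a'\<close> inverts \<open>a\<close> modulo
  \<open>M\<close>. This contradicts \<open>1 = sq n a o\<^sub>L sq n a'\<close> modulo
  \<open>M\<close>, since the \<open>q\<close>-value of the right-hand side would tend to 0.\<close>

lemma maximal_ideal_codim_1:
  assumes max: "maximal_algebra_ideal A M" and a: "a \<in> A"
  obtains c where "a - c *\<^sub>C id_blinfun \<in> M"
proof (rule ccontr)
  assume "\<not> thesis"
  then have none: "a - c *\<^sub>C id_blinfun \<notin> M" for c using that by blast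
  interpret closed_ideal A M
    using max maximal_ideal_closed[OF max] by unfold_locales (simp_all add: maximal_algebra_ideal_def)
  have one: "id_blinfun \<notin> M"
    using ideal_eq_algebra[OF ideal] max by (auto simp: maximal_algebra_ideal_def)
  have "\<exists>x. x \<in> A \<and> ((id_blinfun - z *\<^sub>C a) o\<^sub>L x) - id_blinfun \<in> M" for z
  proof -
    have "id_blinfun - z *\<^sub>C a \<notin> M"
    proof (cases "z = 0")
      case False
      show ?thesis
      proof
        assume "id_blinfun - z *\<^sub>C a \<in> M"
        then have "(- inverse z) *\<^sub>C (id_blinfun - z *\<^sub>C a) \<in> M" by (rule M_closed)
        also have "(- inverse z) *\<^sub>C (id_blinfun - z *\<^sub>C a) = a - inverse z *\<^sub>C id_blinfun"
          using False
          by (simp add: complex_vector.scale_minus_left complex_vector.scale_right_diff_distrib scaleC_scaleC)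
        finally show False using none by blast
      qed
    qed (use one in simp)
    moreover have "id_blinfun - z *\<^sub>C a \<in> A" using a by (intro A_closed)
    ultimately show ?thesis using maximal_ideal_inverse[OF max] by blast
  qed
  then obtain f where f: "\<And>z. f z \<in> A" "\<And>z. ((id_blinfun - z *\<^sub>C a) o\<^sub>L f z) - id_blinfun \<in> M"
    by metis
  have "a \<notin> M" using none[of 0] by simp
  then obtain a' where a': "a' \<in> A" "(a o\<^sub>L a') - id_blinfun \<in> M"
    using maximal_ideal_inverse[OF max a] by blast
  \<comment> \<open>The radius has to reach \<open>q a'\<close>; the extra 1 leaves room for the
    auxiliary point \<open>t = r + d\<close> with \<open>d \<le> 1\<close>.\<close>
  define R where "R = q a' + 1"
  obtain B where B: "B \<ge> 0" "\<And>z. cmod z \<le> R \<Longrightarrow> q (f z) \<le> B"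
    using resolvent_bounded[OF a f] by blast
  define L where "L = q a * (B * B)"
  have L: "L \<ge> 0" using B by (simp add: L_def)
  have lip: "q (f z - f w) \<le> L * cmod (z - w)" if "cmod z \<le> R" "cmod w \<le> R" for z w
  proof -
    have "q (f z - f w) \<le> cmod (z - w) * (q a * (q (f z) * q (f w)))"
      by (rule resolvent_difference[OF a f(1) f(1) f(2) f(2)])
    also have "\<dots> \<le> cmod (z - w) * (q a * (B * B))"
      using that B by (intro mult_left_mono mult_mono) auto
    finally show ?thesis by (simp add: L_def mult.commute)
  qed
  define S where "S r \<longleftrightarrow> (\<lambda>n. r ^ (2 ^ n) * q (sq n a)) \<longlonglongrightarrow> 0" for r
  define d where "d = 1 / (4 * (L + 1))"
  have d: "0 < d" "d \<le> 1" "L * d \<le> 1/4" using L by (simp_all add: d_def field_simps)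
  \<comment> \<open>The radius starts at 0 and advances by \<open>d / 2\<close>, half the distance
    to the auxiliary point, so that \<open>s < t\<close> holds strictly.\<close>
  have S: "S (min (real k * (d / 2)) (q a'))" for k
  proof (induction k)
    case 0
    show ?case by (simp add: S_def zero_power)
  next
    case (Suc k)
    define r where "r = min (real k * (d / 2)) (q a')"
    have "S (min (real (Suc k) * (d / 2)) (q a'))"
      unfolding S_def
    proof (rule radius_extends[where R = R and r = r and t = "r + d", OF a f lip])
      show "0 \<le> r" using d by (simp add: r_def)
      show "r \<le> R" "r + d \<le> R" using d by (auto simp: r_def R_def)
      show "0 \<le> min (real (Suc k) * (d / 2)) (q a')" using d by simp
      show "min (real (Suc k) * (d / 2)) (q a') < r + d"
        using d by (auto simp: r_def min_def algebra_simps)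
      show "L * \<bar>r + d - r\<bar> \<le> 1/4" using d by simp
      show "(\<lambda>n. r ^ (2 ^ n) * q (sq n a)) \<longlonglongrightarrow> 0" using Suc by (simp add: S_def r_def)
    qed
    then show ?case .
  qed
  obtain k where "q a' \<le> real k * (d / 2)"
    using real_arch_simple[of "q a' / (d / 2)"] d by (auto simp: field_simps)
  then have "S (q a')" using S[of k] by (simp add: min_def split: if_splits)
  moreover have "q id_blinfun \<le> q a' ^ (2 ^ n) * q (sq n a)" for n
  proof -
    have "q id_blinfun = q (sq n a o\<^sub>L sq n a')"
      using q_cong[OF sq_inverse[OF a a', of n]] by simp
    also have "\<dots> \<le> q (sq n a) * q (sq n a')" using a a' by (intro q_mult_le sq_closed)
    also have "\<dots> \<le> q (sq n a) * q a' ^ (2 ^ n)" using a' by (intro mult_left_mono q_sq_le) auto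
    finally show ?thesis by (simp add: mult.commute)
  qed
  ultimately have "q id_blinfun \<le> 0"
    unfolding S_def by (intro tendsto_lowerbound[where F = sequentially]) auto
  then show False using one q_eq_0_iff[of id_blinfun] q_nonneg[of id_blinfun] by linarith
qed

end

section \<open>Orbits and reflexivity\<close>

text \<open>Makes the space of bounded continuous functions admissible as the domain type of
  \<open>open_mapping_bound\<close>.\<close>

instance bcontfun :: (metric_space, banach) banach ..

lemma apply_bcontfun_sum_bounded_linear:
  fixes x :: "nat \<Rightarrow> 'b::real_normed_vector"
  shows "bounded_linear
    (\<lambda>F :: nat discrete \<Rightarrow>\<^sub>C ('b \<Rightarrow>\<^sub>L 'c::real_normed_vector). \<Sum>i<p. blinfun_apply (apply_bcontfun F (discrete i)) (x i))"
proof (rule bounded_linear_intro)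
  fix F :: "nat discrete \<Rightarrow>\<^sub>C ('b \<Rightarrow>\<^sub>L 'c)"
  have "norm (\<Sum>i<p. blinfun_apply (apply_bcontfun F (discrete i)) (x i)) \<le> (\<Sum>i<p. norm F * norm (x i))"
    by (intro sum_norm_le order_trans[OF norm_blinfun] mult_right_mono norm_bounded) auto
  then show "norm (\<Sum>i<p. blinfun_apply (apply_bcontfun F (discrete i)) (x i)) \<le> norm F * (\<Sum>i<p. norm (x i))"
    by (simp add: sum_distrib_left)
qed (simp_all add: blinfun.bilinear_simps sum.distrib scaleR_sum_right)

context closed_abelian_algebra begin

lemma orbit_csubspace:
  assumes "csubspace I" "I \<subseteq> A"
  shows "csubspace (orbit I v)"
proof (rule complex_vector.subspaceI)
  show "0 \<in> orbit I v"
    using complex_vector.subspace_0[OF assms(1)] unfolding orbit_def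
    by (intro CollectI exI[of _ 0]) simp
next
  fix x y assume "x \<in> orbit I v" "y \<in> orbit I v"
  then obtain a b where "a \<in> I" "b \<in> I" "x = a v" "y = b v" by (auto simp: orbit_def)
  then show "x + y \<in> orbit I v"
    using complex_vector.subspace_add[OF assms(1)] unfolding orbit_def
    by (intro CollectI exI[of _ "a + b"]) (simp add: blinfun.add_left)
next
  fix c x assume "x \<in> orbit I v"
  then obtain a where "a \<in> I" "x = a v" by (auto simp: orbit_def)
  then show "c *\<^sub>C x \<in> orbit I v"
    using complex_vector.subspace_scale[OF assms(1)] unfolding orbit_def
    by (intro CollectI exI[of _ "c *\<^sub>C a"]) (simp add: blinfun_apply_scaleC)
qed

lemma closure_orbit_Lat: "closure (orbit A v) \<in> Lat A"
proof -
  have "blinfun_apply a ` closure (orbit A v) \<subseteq> closure (orbit A v)" if a: "a \<in> A" for a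
  proof (rule image_closure_subset)
    show "continuous_on (closure (orbit A v)) (blinfun_apply a)" by (intro continuous_intros)
    show "blinfun_apply a ` orbit A v \<subseteq> closure (orbit A v)"
      using mult_closed[OF a] closure_subset[of "orbit A v"]
      by (fastforce simp: orbit_def simp flip: blinfun_apply_blinfun_compose)
  qed simp
  then show ?thesis
    unfolding Lat_def using csubspace by (auto intro!: csubspace_closure orbit_csubspace)
qed

section \<open>Annihilators and the components of the direct sum\<close>

definition annihilator :: "'a \<Rightarrow> ('a \<Rightarrow>\<^sub>L 'a) set"
  where "annihilator v = {a \<in> A. blinfun_apply a v = 0}"

lemma annihilator_ideal: "algebra_ideal A (annihilator v)"
proof (rule algebra_idealI)
  show "csubspace (annihilator v)"
    unfolding annihilator_def
    by (rule complex_vector.subspaceI)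
      (auto simp: blinfun.add_left blinfun_apply_scaleC intro: A_closed)
qed (auto simp: annihilator_def blinfun.zero_right intro: A_closed)

lemma annihilator_closed: "closed (annihilator v)"
proof -
  have "annihilator v = A \<inter> (\<lambda>a. blinfun_apply a v) -` {0}" by (auto simp: annihilator_def)
  moreover have "closed ((\<lambda>a::'a \<Rightarrow>\<^sub>L 'a. blinfun_apply a v) -` {0})"
    by (intro closed_vimage closed_singleton continuous_intros)
  ultimately show ?thesis using closed by (simp add: closed_Int)
qed

text \<open>Only the components are determined by the sum; each coefficient \<open>a i\<close> is
  determined up to \<open>annihilator (x i)\<close>.\<close>

lemma orbit_coefficients_unique:
  assumes dec: "direct_sum_decomposition p (\<lambda>i. orbit A (x i))"
    and A: "\<And>i. i < p \<Longrightarrow> a i \<in> A" "\<And>i. i < p \<Longrightarrow> b i \<in> A"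
    and eq: "(\<Sum>i<p. blinfun_apply (a i) (x i)) = (\<Sum>i<p. blinfun_apply (b i) (x i))"
    and i: "i < p"
  shows "blinfun_apply (a i) (x i) = blinfun_apply (b i) (x i)"
proof -
  \<comment> \<open>The restriction to \<open>{..<p}\<close> makes the families extensional, as
    uniqueness in the decomposition is stated for \<open>\<Pi>\<^sub>E\<close>.\<close>
  define y where "y a = (\<lambda>i\<in>{..<p}. blinfun_apply (a i) (x i))" for a :: "nat \<Rightarrow> ('a \<Rightarrow>\<^sub>L 'a)"
  define s where "s = (\<Sum>i<p. blinfun_apply (a i) (x i))"
  have "y a \<in> (\<Pi>\<^sub>E i\<in>{..<p}. orbit A (x i)) \<and> s = (\<Sum>i<p. y a i)"
    using A(1) by (auto simp: y_def s_def orbit_def)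
  moreover have "y b \<in> (\<Pi>\<^sub>E i\<in>{..<p}. orbit A (x i)) \<and> s = (\<Sum>i<p. y b i)"
    using A(2) eq by (auto simp: y_def s_def orbit_def)
  ultimately have "y a = y b"
    using dec unfolding direct_sum_decomposition_def by blast
  then have "y a i = y b i" by simp
  then show ?thesis using i by (simp add: y_def)
qed

text \<open>
  The space \<open>A\<^sup>p\<close> is modelled inside the Banach space of bounded functions on the discrete natural
  numbers, because \<open>p\<close> is not a type; only the coordinates below \<open>p\<close> matter.
\<close>

lemma bounded_orbit_coefficients:
  assumes dec: "direct_sum_decomposition p (\<lambda>i. orbit A (x i))"
  obtains C where "C \<ge> 0"
    "\<And>y. \<exists>a. (\<forall>i<p. a i \<in> A \<and> norm (a i) \<le> C * norm y) \<and> y = (\<Sum>i<p. blinfun_apply (a i) (x i))"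
proof -
  define S where "S = {F :: nat discrete \<Rightarrow>\<^sub>C ('a \<Rightarrow>\<^sub>L 'a). \<forall>i<p. apply_bcontfun F (discrete i) \<in> A}"
  define f where "f F = (\<Sum>i<p. blinfun_apply (apply_bcontfun F (discrete i)) (x i))" for F :: "nat discrete \<Rightarrow>\<^sub>C ('a \<Rightarrow>\<^sub>L 'a)"
  have eval: "bounded_linear (\<lambda>F :: nat discrete \<Rightarrow>\<^sub>C ('a \<Rightarrow>\<^sub>L 'a). apply_bcontfun F (discrete i))" for i
    by (rule bounded_linear_intro[of _ 1]) (auto intro: norm_bounded)
  have "S = (\<Inter>i\<in>{..<p}. (\<lambda>F. apply_bcontfun F (discrete i)) -` A)" by (auto simp: S_def)
  also have "closed \<dots>"
    by (intro closed_INT ballI closed_vimage closed linear_continuous_on eval)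
  finally have 1: "closed S" .
  have 2: "subspace S"
    using A_closed(7) A_closed(3) A_closed(5)[of _ "complex_of_real _"]
    by (auto simp: subspace_def S_def scaleC_of_real)
  have 3: "f ` S = UNIV"
  proof (intro set_eqI iffI UNIV_I)
    fix y
    obtain u where u: "u \<in> (\<Pi>\<^sub>E i\<in>{..<p}. orbit A (x i))" "y = (\<Sum>i<p. u i)"
      using dec unfolding direct_sum_decomposition_def by blast
    then have "\<forall>i\<in>{..<p}. \<exists>a. a \<in> A \<and> u i = blinfun_apply a (x i)"
      by (fastforce simp: orbit_def dest: PiE_mem)
    then obtain a where a: "\<And>i. i < p \<Longrightarrow> a i \<in> A" "\<And>i. i < p \<Longrightarrow> u i = blinfun_apply (a i) (x i)"
      by (metis lessThan_iff)
    \<comment> \<open>Extension by 0 beyond \<open>p\<close> leaves a finite range, hence a bounded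
      function; continuity is automatic on a discrete space.\<close>
    define b where "b k = (if of_discrete k < p then a (of_discrete k) else 0)" for k
    have "finite (range b)"
      by (rule finite_subset[of _ "insert 0 (a ` {..<p})"]) (auto simp: b_def)
    then have "b \<in> bcontfun"
      by (simp add: bcontfun_def finite_imp_bounded continuous_on_open_vimage open_discrete)
    then obtain F where F: "b = apply_bcontfun F" by (rule bcontfunE)
    have "F \<in> S" "f F = y" using a u(2) by (simp_all add: S_def f_def b_def discrete_inverse flip: F)
    then show "y \<in> f ` S" by blast
  qed
  have 0: "bounded_linear f" unfolding f_def by (rule apply_bcontfun_sum_bounded_linear)
  obtain C where C: "C \<ge> 0" "\<And>y. \<exists>F\<in>S. f F = y \<and> norm F \<le> C * norm y"
    by (rule open_mapping_bound[OF 0 1 2 3]) blast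
  have "\<exists>a. (\<forall>i<p. a i \<in> A \<and> norm (a i) \<le> C * norm y) \<and> y = (\<Sum>i<p. blinfun_apply (a i) (x i))" for y
  proof -
    obtain F where F: "F \<in> S" "f F = y" "norm F \<le> C * norm y" using C(2) by blast
    have "norm (apply_bcontfun F (discrete i)) \<le> C * norm y" for i
      using norm_bounded[of F "discrete i"] F(3) by simp
    then show ?thesis using F(1,2) by (intro exI[of _ "\<lambda>i. apply_bcontfun F (discrete i)"]) (auto simp: S_def f_def)
  qed
  with C(1) show thesis by (rule that)
qed

text \<open>The point is closedness. If \<open>m k\<close> applied to \<open>x i\<close> tends to
  \<open>a\<close> applied to \<open>x i\<close>, the bounded coefficients show that
  \<open>a\<close> has distance tending to 0 from \<open>m k + annihilator (x i)\<close>, a subset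
  of \<open>M\<close>, so \<open>a\<close> lies in the closed set \<open>M\<close>.\<close>

lemma orbit_ideal_Lat:
  assumes dec: "direct_sum_decomposition p (\<lambda>i. orbit A (x i))" and i: "i < p"
    and orb: "closed (orbit A (x i))"
    and M: "algebra_ideal A M" "closed M" "annihilator (x i) \<subseteq> M"
  shows "orbit M (x i) \<in> Lat A"
proof -
  interpret M: closed_ideal A M by unfold_locales (rule M)+
  obtain C where C: "C \<ge> 0"
    "\<And>y. \<exists>a. (\<forall>i<p. a i \<in> A \<and> norm (a i) \<le> C * norm y) \<and> y = (\<Sum>i<p. blinfun_apply (a i) (x i))"
    using bounded_orbit_coefficients[OF dec] by blast
  have "closed (orbit M (x i))"
    unfolding closed_sequential_limits
  proof safe
    fix s y assume s: "\<forall>n. s n \<in> orbit M (x i)" and lim: "s \<longlonglongrightarrow> y"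
    then obtain m where m: "\<And>n. m n \<in> M" "\<And>n. s n = blinfun_apply (m n) (x i)"
      unfolding orbit_def mem_Collect_eq by metis
    have "\<forall>n. s n \<in> orbit A (x i)" using m M.ideal_subset by (auto simp: orbit_def)
    then have "y \<in> orbit A (x i)" using closed_sequentially[OF orb _ lim] by blast
    then obtain a where a: "a \<in> A" "y = blinfun_apply a (x i)" by (auto simp: orbit_def)
    have "\<exists>n\<in>M. norm (a - n) \<le> C * norm (y - s k)" for k
    proof -
      obtain c where c: "\<And>j. j < p \<Longrightarrow> c j \<in> A" "\<And>j. j < p \<Longrightarrow> norm (c j) \<le> C * norm (y - s k)"
        "y - s k = (\<Sum>j<p. blinfun_apply (c j) (x j))"
        using C(2)[of "y - s k"] by blast
      \<comment> \<open>A second expansion of \<open>y - s k\<close>, concentrated in the component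
        \<open>i\<close>. Comparison with \<open>c\<close> shows that \<open>a - m k\<close> and the
        small \<open>c i\<close> differ by an element of the annihilator.\<close>
      define d where "d j = (if j = i then a - m k else 0)" for j
      have d: "d j \<in> A" for j using a(1) M.ideal_subset[OF m(1)] by (auto simp: d_def intro: A_closed)
      have "(\<Sum>j<p. blinfun_apply (d j) (x j)) = (\<Sum>j<p. if j = i then y - s k else 0)"
        by (intro sum.cong) (auto simp: d_def a m blinfun.diff_left)
      also have "\<dots> = y - s k" using i by simp
      finally have "blinfun_apply (c i) (x i) = blinfun_apply (d i) (x i)"
        using c i d by (intro orbit_coefficients_unique[OF dec]) auto
      then have "(a - m k) - c i \<in> annihilator (x i)"
        using c(1)[OF i] d[of i] by (auto simp: annihilator_def d_def blinfun.diff_left intro: A_closed)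
      then have "((a - m k) - c i) + m k \<in> M" using M(3) m(1) M.M_closed(3) by blast
      then have "a - c i \<in> M" by (simp add: algebra_simps)
      then show ?thesis using c(2)[OF i] by (intro bexI[of _ "a - c i"]) simp_all
    qed
    then obtain n where n: "\<And>k. n k \<in> M" "\<And>k. norm (a - n k) \<le> C * norm (y - s k)" by metis
    have "(\<lambda>k. C * norm (y - s k)) \<longlonglongrightarrow> C * norm (y - y)" by (intro tendsto_intros lim)
    then have "(\<lambda>k. C * norm (y - s k)) \<longlonglongrightarrow> 0" by simp
    then have "(\<lambda>k. a - n k) \<longlonglongrightarrow> 0"
      by (rule Lim_null_comparison[rotated]) (simp add: n(2))
    from tendsto_diff[OF tendsto_const[of a] this] have "n \<longlonglongrightarrow> a" by simp
    then have "a \<in> M" by (rule closed_sequentially[where f = n, OF M(2) n(1)])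
    then show "y \<in> orbit M (x i)" using a by (auto simp: orbit_def)
  qed
  moreover have "blinfun_apply a ` orbit M (x i) \<subseteq> orbit M (x i)" if "a \<in> A" for a
    using M.ideal_mult(1)[OF that] by (fastforce simp: orbit_def simp flip: blinfun_apply_blinfun_compose)
  moreover have "csubspace (orbit M (x i))"
    using M.ideal_csubspace M.ideal_subset by (intro orbit_csubspace) auto
  ultimately show ?thesis by (auto simp: Lat_def)
qed

text \<open>With \<open>t\<close> and \<open>c\<close> representing the values of \<open>T\<close>
  at \<open>x i\<close> and at \<open>a\<close> applied to \<open>x i\<close>, the claim is that
  \<open>c - (a o\<^sub>L t)\<close> annihilates \<open>x i\<close>. By spectral synthesis this may
  be checked modulo each maximal ideal containing the annihilator.\<close>

lemma algLat_commutes_on_orbit: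
  assumes dec: "direct_sum_decomposition p (\<lambda>i. orbit A (x i))" and i: "i < p"
    and orb: "closed (orbit A (x i))" and synth: "spectral_synthesis A"
    and T: "T \<in> algLat A" and a: "a \<in> A"
  shows "blinfun_apply T (blinfun_apply a (x i)) = blinfun_apply a (blinfun_apply T (x i))"
proof -
  let ?v = "x i"
  have T_Lat: "blinfun_apply T u \<in> K" if "K \<in> Lat A" "u \<in> K" for K u
    using T that by (auto simp: algLat_def)
  have T_scale: "blinfun_apply T (c *\<^sub>C u) = c *\<^sub>C blinfun_apply T u" for c u
    using T by (simp add: algLat_def bounded_operators_iff)
  have "orbit A ?v \<in> Lat A"
    using closure_orbit_Lat[of ?v] orb by simp
  then have orbT: "blinfun_apply T u \<in> orbit A ?v" if "u \<in> orbit A ?v" for u using T_Lat that by blast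
  have "blinfun_apply id_blinfun ?v \<in> orbit A ?v" using one_closed unfolding orbit_def by blast
  then obtain t where t: "t \<in> A" "blinfun_apply T ?v = blinfun_apply t ?v"
    using orbT[of ?v] by (auto simp: orbit_def)
  obtain c where c: "c \<in> A" "blinfun_apply T (blinfun_apply a ?v) = blinfun_apply c ?v"
    using orbT[of "blinfun_apply a ?v"] a by (auto simp: orbit_def)
  have "c - (a o\<^sub>L t) \<in> M" if max: "maximal_algebra_ideal A M" and ann: "annihilator ?v \<subseteq> M" for M
  proof -
    interpret M: closed_ideal A M
      using max maximal_ideal_closed[OF max] by unfold_locales (simp_all add: maximal_algebra_ideal_def)
    obtain k where k: "a - k *\<^sub>C id_blinfun \<in> M" using maximal_ideal_codim_1[OF max a] .
    \<comment> \<open>Modulo \<open>M\<close> the element \<open>a\<close> is the scalar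
      \<open>k\<close>, with which \<open>T\<close> commutes; the remainder \<open>m\<close> sends
      \<open>x i\<close> into \<open>orbit M (x i)\<close>, which \<open>T\<close>
      preserves.\<close>
    define m where "m = a - k *\<^sub>C id_blinfun"
    have m: "m \<in> M" using k by (simp add: m_def)
    have "orbit M ?v \<in> Lat A" by (rule orbit_ideal_Lat[OF dec i orb M.ideal M.closed_ideal ann])
    moreover have "blinfun_apply m ?v \<in> orbit M ?v" using m by (auto simp: orbit_def)
    ultimately obtain n where n: "n \<in> M" "blinfun_apply T (blinfun_apply m ?v) = blinfun_apply n ?v"
      using T_Lat by (auto simp: orbit_def)
    have "blinfun_apply c ?v = blinfun_apply T (blinfun_apply m ?v + k *\<^sub>C ?v)"
      by (simp add: m_def blinfun.diff_left blinfun_apply_scaleC flip: c(2))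
    also have "\<dots> = blinfun_apply n ?v + k *\<^sub>C blinfun_apply t ?v"
      by (simp add: blinfun.add_right T_scale n t)
    also have "k *\<^sub>C blinfun_apply t ?v = blinfun_apply a (blinfun_apply t ?v) - blinfun_apply m (blinfun_apply t ?v)"
      by (simp add: m_def blinfun.diff_left blinfun_apply_scaleC)
    finally have "blinfun_apply (c - (a o\<^sub>L t) - (n - (m o\<^sub>L t))) ?v = 0"
      by (simp add: blinfun.diff_left)
    moreover have "c - (a o\<^sub>L t) - (n - (m o\<^sub>L t)) \<in> A"
      using a t(1) c(1) n(1) m M.ideal_subset by (intro A_closed) auto
    ultimately have "c - (a o\<^sub>L t) - (n - (m o\<^sub>L t)) \<in> M" using ann by (auto simp: annihilator_def)
    moreover have "n - (m o\<^sub>L t) \<in> M" by (intro M.M_closed(2,4) n m t)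
    ultimately have "c - (a o\<^sub>L t) - (n - (m o\<^sub>L t)) + (n - (m o\<^sub>L t)) \<in> M"
      by (rule M.M_closed(3))
    then show ?thesis by simp
  qed
  moreover have "annihilator ?v = A \<inter> \<Inter>{M. maximal_algebra_ideal A M \<and> annihilator ?v \<subseteq> M}"
    using synth[unfolded spectral_synthesis_def, rule_format, of "annihilator ?v"]
      annihilator_ideal[of ?v] closed_subset[OF _ annihilator_closed[of ?v], of A]
    by (simp add: algebra_ideal_def)
  moreover have "c - (a o\<^sub>L t) \<in> A" using a t(1) c(1) by (intro A_closed)
  ultimately have "c - (a o\<^sub>L t) \<in> annihilator ?v" by blast
  then show ?thesis using c(2) t(2) by (simp add: annihilator_def blinfun.diff_left)
qed

text \<open>Each generator \<open>x i\<close> has its own \<open>t i\<close> in \<open>A\<close>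
  that agrees with \<open>T\<close> there. A single sequence in \<open>A\<close> approximating
  \<open>T\<close> at all generators is obtained first, and commutation on the orbits carries the
  convergence to the whole space.\<close>

lemma algLat_subset:
  assumes dec: "direct_sum_decomposition p (\<lambda>i. orbit A (x i))"
    and orb: "\<And>i. i < p \<Longrightarrow> closed (orbit A (x i))" and synth: "spectral_synthesis A"
    and sc: "strongly_closed A" and T: "T \<in> algLat A"
  shows "T \<in> A"
proof -
  obtain C where C: "C \<ge> 0"
    "\<And>y. \<exists>a. (\<forall>i<p. a i \<in> A \<and> norm (a i) \<le> C * norm y) \<and> y = (\<Sum>i<p. blinfun_apply (a i) (x i))"
    using bounded_orbit_coefficients[OF dec] by blast
  have T_Lat: "blinfun_apply T u \<in> K" if "K \<in> Lat A" "u \<in> K" for K u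
    using T that by (auto simp: algLat_def)
  have in_orbit: "v \<in> orbit A v" for v
    using one_closed unfolding orbit_def by (intro CollectI exI[of _ id_blinfun]) simp
  \<comment> \<open>Approximation of \<open>T v\<close> along \<open>orbit A v\<close> splits into
    approximations at every \<open>x i\<close>, because the norm bound on coefficients makes the
    projections continuous.\<close>
  define v where "v = (\<Sum>i<p. x i)"
  have "blinfun_apply T v \<in> closure (orbit A v)"
    using T_Lat[OF closure_orbit_Lat] in_orbit closure_subset by blast
  then obtain s where s: "\<And>n. s n \<in> orbit A v" "s \<longlonglongrightarrow> blinfun_apply T v"
    unfolding closure_sequential by blast
  then obtain a where a: "\<And>n. a n \<in> A" "\<And>n. s n = blinfun_apply (a n) v"
    unfolding orbit_def mem_Collect_eq by metis
  have "\<exists>t. t \<in> A \<and> blinfun_apply T (x i) = blinfun_apply t (x i)" if "i < p" for i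
    using T_Lat[OF closure_orbit_Lat, of "x i" "x i"] orb[OF that] in_orbit by (auto simp: orbit_def)
  then obtain t where t: "\<And>i. i < p \<Longrightarrow> t i \<in> A"
    "\<And>i. i < p \<Longrightarrow> blinfun_apply T (x i) = blinfun_apply (t i) (x i)" by metis
  have lim: "(\<lambda>n. blinfun_apply (a n) (x i)) \<longlonglongrightarrow> blinfun_apply T (x i)" if i: "i < p" for i
  proof -
    have le: "norm (blinfun_apply (a n) (x i) - blinfun_apply T (x i)) \<le>
        C * norm (s n - blinfun_apply T v) * norm (x i)" for n
    proof -
      obtain c where c: "\<And>j. j < p \<Longrightarrow> c j \<in> A"
        "\<And>j. j < p \<Longrightarrow> norm (c j) \<le> C * norm (s n - blinfun_apply T v)"
        "s n - blinfun_apply T v = (\<Sum>j<p. blinfun_apply (c j) (x j))"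
        using C(2)[of "s n - blinfun_apply T v"] by blast
      have "s n - blinfun_apply T v = (\<Sum>j<p. blinfun_apply (a n) (x j) - blinfun_apply T (x j))"
        by (simp add: a v_def blinfun.sum_right sum_subtractf)
      also have "\<dots> = (\<Sum>j<p. blinfun_apply (a n - t j) (x j))"
        using t by (intro sum.cong) (auto simp: blinfun.diff_left)
      finally have "blinfun_apply (a n - t i) (x i) = blinfun_apply (c i) (x i)"
        using a t c i by (intro orbit_coefficients_unique[OF dec]) (auto intro: A_closed)
      then have "norm (blinfun_apply (a n) (x i) - blinfun_apply T (x i)) = norm (blinfun_apply (c i) (x i))"
        using t(2)[OF i] by (simp add: blinfun.diff_left)
      also have "\<dots> \<le> norm (c i) * norm (x i)" by (rule norm_blinfun)
      also have "\<dots> \<le> C * norm (s n - blinfun_apply T v) * norm (x i)"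
        using c(2)[OF i] by (intro mult_right_mono) auto
      finally show ?thesis .
    qed
    have "(\<lambda>n. C * norm (s n - blinfun_apply T v) * norm (x i)) \<longlonglongrightarrow>
        C * norm (blinfun_apply T v - blinfun_apply T v) * norm (x i)"
      by (intro tendsto_intros s)
    then have "(\<lambda>n. C * norm (s n - blinfun_apply T v) * norm (x i)) \<longlonglongrightarrow> 0" by simp
    then have "(\<lambda>n. blinfun_apply (a n) (x i) - blinfun_apply T (x i)) \<longlonglongrightarrow> 0"
      by (rule Lim_null_comparison[rotated]) (simp add: le)
    then show ?thesis by (rule LIM_zero_cancel)
  qed
  show "T \<in> A"
  proof (rule strongly_closed_limit[OF sc _ a(1)])
    show "T \<in> bounded_operators" using T by (simp add: algLat_def)
    fix y
    \<comment> \<open>Both \<open>a n\<close> and \<open>T\<close> can be moved past the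
      coefficients \<open>b i\<close>, so convergence at \<open>y\<close> reduces to convergence at
      the generators.\<close>
    obtain b where b: "\<And>i. i < p \<Longrightarrow> b i \<in> A" "y = (\<Sum>i<p. blinfun_apply (b i) (x i))"
      using C(2)[of y] by blast
    have "blinfun_apply (a n) y = (\<Sum>i<p. blinfun_apply (b i) (blinfun_apply (a n) (x i)))" for n
      unfolding b(2) blinfun.sum_right
      using commute[OF a(1) b(1)]
      by (intro sum.cong) (auto simp flip: blinfun_apply_blinfun_compose)
    moreover have "blinfun_apply T y = (\<Sum>i<p. blinfun_apply (b i) (blinfun_apply T (x i)))"
      unfolding b(2) blinfun.sum_right
      using algLat_commutes_on_orbit[OF dec _ orb synth T b(1)]
      by (intro sum.cong) auto
    moreover have "(\<lambda>n. \<Sum>i<p. blinfun_apply (b i) (blinfun_apply (a n) (x i))) \<longlonglongrightarrow>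
        (\<Sum>i<p. blinfun_apply (b i) (blinfun_apply T (x i)))"
      by (intro tendsto_sum blinfun.tendsto tendsto_const lim) simp
    ultimately show "(\<lambda>n. blinfun_apply (a n) y) \<longlonglongrightarrow> blinfun_apply T y" by simp
  qed
qed

end

theorem corollary6:
  fixes A :: "('a::complex_banach \<Rightarrow>\<^sub>L 'a) set" and p :: nat
  assumes "operator_algebra A" and "abelian A" and "unital A" and "strongly_closed A"
    and "spectral_synthesis A"
    and "has_split_strict_multiplicity A p"
  shows "reflexive A"
proof -
  have sub: "A \<subseteq> bounded_operators" using assms(1) by (simp add: operator_algebra_def)
  interpret closed_abelian_algebra A
    using assms strongly_closed_imp_closed sub by unfold_locales
  obtain x where "\<And>i. i < p \<Longrightarrow> closed (orbit A (x i))"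
    "direct_sum_decomposition p (\<lambda>i. orbit A (x i))"
    using assms(6) by (auto simp: has_split_strict_multiplicity_def)
  then have "algLat A \<subseteq> A" using algLat_subset assms(4,5) by blast
  moreover have "A \<subseteq> algLat A" using sub by (auto simp: algLat_def Lat_def)
  ultimately show ?thesis by (simp add: reflexive_def)
qed

end
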